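(* Let $k\ge3$. The space $K^{(k)}$ has Hausdorff dimension $$\frac{\log k}{\log(k^2-k-1)-\log(k(k-2))}$$ with respect to the effective resistance metric.
   Context: Let $\mathsf{X}_k=\{0,\dots,k-1\}$. Let $p_0,\dots,p_{k-1}$ be the vertices of a regular simplex in $\mathbb{R}^{k-1}$ (with $k$ vertices), and let $q_i=\frac1{k-1}\sum_{j\neq i}p_j$. For $i\in\mathsf{X}_k$ let $F_i:\mathbb{R}^{k-1}\to\mathbb{R}^{k-1}$ be the unique affine map with $F_i(p_i)=p_i$ and $F_i(p_j)=q_j$ for $j\ne i$; each $F_i$ is a contraction. $K^{(k)}$ is the unique nonempty compact set with $K^{(k)}=\bigcup_{i\in\mathsf{X}_k}F_i(K^{(k)})$. Set $V_0=\{p_i: i\in\mathsf{X}_k\}$, $V_{m+1}=\bigcup_{i}F_i(V_m)$ and $V_*=\bigcup_{m\ge0}V_m$, which is dense in $K^{(k)}$. Let $r=\frac{k(k-2)}{k^2-k-1}$, $\mathcal{E}_0(u)=\sum_{i<j}(u(p_i)-u(p_j))^2$ for $u:V_0\to\mathbb{R}$, and $\mathcal{E}_m(u)=r^{-1}\sum_{i\in\mathsf{X}_k}\mathcal{E}_{m-1}(u\circ F_i)$ for $u:V_m\to\mathbb{R}$, $m\ge1$. With this choice of $r$, for each $u$ on $V_{m-1}$ the minimum of $\mathcal{E}_m$ over extensions of $u$ to $V_m$ equals $\mathcal{E}_{m-1}(u)$, so for $u:V_*\to\mathbb{R}$ the sequence $\mathcal{E}_m(u|_{V_m})$ is nondecreasing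 and one sets $\mathcal{E}(u)=\lim_{m\to\infty}\mathcal{E}_m(u|_{V_m})\in[0,\infty]$. The effective resistance is defined for distinct $x,y\in V_*$ by $R(x,y)^{-1}=\min\{\mathcal{E}(u):u(x)=0,\ u(y)=1\}$ (and $R(x,x)=0$); it extends by continuity to a metric $R$ on $K^{(k)}$, called the effective resistance metric. *)

theory Defs
  imports "HOL-Analysis.Analysis"
begin

section \<open>Hausdorff dimension of a metric space \<open>(M, d)\<close>\<close>

definition mdiam :: "('a \<Rightarrow> 'a \<Rightarrow> real) \<Rightarrow> 'a set \<Rightarrow> ennreal" where
  "mdiam d A = (SUP x\<in>A. SUP y\<in>A. ennreal (d x y))"

text \<open>
  The gauge is the \<open>s\<close>-th power of the diameter, with value 0 on the empty set and with the
  convention \<open>0\<^sup>0 = 1\<close> on nonempty sets (whereas \<^term>\<open>0 powr 0 = (0::real)\<close>).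
  It is only ever applied to sets of finite diameter.
\<close>
definition hausdorff_gauge :: "('a \<Rightarrow> 'a \<Rightarrow> real) \<Rightarrow> real \<Rightarrow> 'a set \<Rightarrow> ennreal" where
  "hausdorff_gauge d s A =
     (if A = {} then 0 else if s = 0 then 1 else ennreal (enn2real (mdiam d A) powr s))"

definition delta_covers :: "'a set \<Rightarrow> ('a \<Rightarrow> 'a \<Rightarrow> real) \<Rightarrow> real \<Rightarrow> (nat \<Rightarrow> 'a set) set" where
  "delta_covers M d \<delta> = {A. (\<Union>n. A n) = M \<and> (\<forall>n. mdiam d (A n) \<le> ennreal \<delta>)}"

definition hausdorff_measure :: "'a set \<Rightarrow> ('a \<Rightarrow> 'a \<Rightarrow> real) \<Rightarrow> real \<Rightarrow> ennreal" where
  "hausdorff_measure M d s =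
     (SUP \<delta>\<in>{0<..}. INF A\<in>delta_covers M d \<delta>. \<Sum>n. hausdorff_gauge d s (A n))"

definition hausdorff_dim :: "'a set \<Rightarrow> ('a \<Rightarrow> 'a \<Rightarrow> real) \<Rightarrow> ereal" where
  "hausdorff_dim M d = (INF s\<in>{s. 0 \<le> s \<and> hausdorff_measure M d s = 0}. ereal s)"


section \<open>The self-similar set \<open>K\<close>\<close>

text \<open>
  Throughout, \<open>p\<close> lists the vertices \<open>p 0, \<dots>, p (k - 1)\<close>; its values at indices \<open>\<ge> k\<close> are
  irrelevant.
\<close>

definition regular_simplex :: "nat \<Rightarrow> (nat \<Rightarrow> 'a::euclidean_space) \<Rightarrow> bool" where
  "regular_simplex k p \<longleftrightarrow>
     inj_on p {..<k} \<and> \<not> affine_dependent (p ` {..<k}) \<and>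
     (\<exists>c>0. \<forall>i<k. \<forall>j<k. i \<noteq> j \<longrightarrow> dist (p i) (p j) = c)"

definition affine_map :: "('a::real_vector \<Rightarrow> 'b::real_vector) \<Rightarrow> bool" where
  "affine_map f \<longleftrightarrow> (\<exists>L b. linear L \<and> f = (\<lambda>x. L x + b))"

definition qpt :: "nat \<Rightarrow> (nat \<Rightarrow> 'a::euclidean_space) \<Rightarrow> nat \<Rightarrow> 'a" where
  "qpt k p i = (1 / (real k - 1)) *\<^sub>R (\<Sum>j\<in>{..<k} - {i}. p j)"

definition F :: "nat \<Rightarrow> (nat \<Rightarrow> 'a::euclidean_space) \<Rightarrow> nat \<Rightarrow> 'a \<Rightarrow> 'a" where
  "F k p i = (THE f. affine_map f \<and> f (p i) = p i \<and> (\<forall>j<k. j \<noteq> i \<longrightarrow> f (p j) = qpt k p j))"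

definition K :: "nat \<Rightarrow> (nat \<Rightarrow> 'a::euclidean_space) \<Rightarrow> 'a set" where
  "K k p = (THE S. S \<noteq> {} \<and> compact S \<and> S = (\<Union>i<k. F k p i ` S))"

primrec V :: "nat \<Rightarrow> (nat \<Rightarrow> 'a::euclidean_space) \<Rightarrow> nat \<Rightarrow> 'a set" where
  "V k p 0 = p ` {..<k}"
| "V k p (Suc m) = (\<Union>i<k. F k p i ` V k p m)"

definition Vstar :: "nat \<Rightarrow> (nat \<Rightarrow> 'a::euclidean_space) \<Rightarrow> 'a set" where
  "Vstar k p = (\<Union>m. V k p m)"


section \<open>Energy and effective resistance\<close>

definition renorm :: "nat \<Rightarrow> real" where
  "renorm k = (real k * (real k - 2)) / ((real k)\<^sup>2 - real k - 1)"

text \<open>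
  Functions on \<^term>\<open>V k p m\<close> and on \<^term>\<open>Vstar k p\<close> are represented by functions on the
  whole space; \<open>energy_level k p m u\<close> only uses the values of \<open>u\<close> on \<^term>\<open>V k p m\<close>.
\<close>
primrec energy_level :: "nat \<Rightarrow> (nat \<Rightarrow> 'a::euclidean_space) \<Rightarrow> nat \<Rightarrow> ('a \<Rightarrow> real) \<Rightarrow> real" where
  "energy_level k p 0 u = (\<Sum>j<k. \<Sum>i<j. (u (p i) - u (p j))\<^sup>2)"
| "energy_level k p (Suc m) u = inverse (renorm k) * (\<Sum>i<k. energy_level k p m (u \<circ> F k p i))"

definition energy :: "nat \<Rightarrow> (nat \<Rightarrow> 'a::euclidean_space) \<Rightarrow> ('a \<Rightarrow> real) \<Rightarrow> ennreal" where
  "energy k p u = lim (\<lambda>m. ennreal (energy_level k p m u))"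

text \<open>The infimum below is attained for distinct \<open>x\<close>, \<open>y\<close> in \<^term>\<open>Vstar k p\<close>.\<close>
definition resistance :: "nat \<Rightarrow> (nat \<Rightarrow> 'a::euclidean_space) \<Rightarrow> 'a \<Rightarrow> 'a \<Rightarrow> real" where
  "resistance k p x y =
     (if x = y then 0
      else enn2real (inverse (INF u\<in>{u. u x = 0 \<and> u y = 1}. energy k p u)))"

text \<open>
  The extension of the resistance from \<^term>\<open>Vstar k p\<close> to \<^term>\<open>K k p\<close> by continuity, with
  respect to the Euclidean topology. Values outside \<^term>\<open>K k p\<close> are set to 0 only to make the
  function unique.
\<close>
definition resistance_metric :: "nat \<Rightarrow> (nat \<Rightarrow> 'a::euclidean_space) \<Rightarrow> 'a \<Rightarrow> 'a \<Rightarrow> real" where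
  "resistance_metric k p =
     (THE R. continuous_on (K k p \<times> K k p) (\<lambda>(x, y). R x y) \<and>
             (\<forall>x\<in>Vstar k p. \<forall>y\<in>Vstar k p. R x y = resistance k p x y) \<and>
             (\<forall>x y. (x, y) \<notin> K k p \<times> K k p \<longrightarrow> R x y = 0))"

end

theory Submission
  imports Defs
begin

text \<open>
  The set \<open>K\<close> is finitely ramified: the cells \<open>F\<^sub>w(K)\<close> of a fixed level \<open>m\<close> meet only in images of
  the vertices. On the side of the energy, one subdivision splits the form into \<open>k\<close> copies of itself
  scaled by \<open>1/r\<close>, where \<open>r\<close> is the factor for which the energies never decrease and for which some
  extension of every function from one level to the next keeps the energy. Consequently a cell of
  level \<open>m\<close> has resistance diameter comparable to \<open>r\<^sup>m\<close>, there are \<open>k\<^sup>m\<close> such cells, and the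
  dimension is the exponent \<open>s\<close> with \<open>k r\<^sup>s = 1\<close>, that is \<open>ln k / ln (1/r)\<close>.

  Upper bound on distances. If \<open>u\<close> has energy at most 1, its oscillation on a cell of level \<open>m\<close> is
  \<open>O(\<surd>r\<^sup>m)\<close>: walk from a point to a vertex through the cells containing it and sum a geometric series
  (\<open>osc_vertex\<close>, \<open>osc_cell\<close>). Since \<open>\<surd>R(x,y)\<close> is the supremum of \<open>|u(x) - u(y)|\<close> over such
  \<open>u\<close> (\<open>resistance_eq\<close>), the resistance is uniformly continuous for the Euclidean metric, so that its
  continuous extension to \<open>K\<close> exists, and cells have diameter \<open>O(r\<^sup>m)\<close>. Covering \<open>K\<close> by all cells of
  one level bounds the dimension from above (\<open>hausdorff_measure_zero\<close>).

  Lower bound on distances. Take the function that is 1 at the vertices of one cell of level \<open>m\<close>, 0 at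
  the other vertices of that level, and extend it harmonically. Its energy is \<open>O(r\<^sup>-\<^sup>m)\<close>, because a
  cell shares vertices with at most \<open>k\<^sup>2\<close> cells of its level. So two cells of level \<open>m\<close> without a common
  vertex are at distance at least \<open>c r\<^sup>m\<close> (\<open>resistance_metric_separated\<close>), and a set of smaller
  diameter meets at most \<open>k\<^sup>2\<close> cells of that level. The lower bound on the dimension then reduces to
  counting: a family of words of total weight less than one, a word of length \<open>m\<close> weighing \<open>k\<^sup>-\<^sup>m\<close>,
  misses some infinite word (\<open>infinite_word_avoiding\<close>), and that word is the address of a point of
  \<open>K\<close> left uncovered.
\<close>

section \<open>Pair sums, diameters and infinite words\<close>

lemma sum_pairs_sq_diff:
  fixes x :: "nat \<Rightarrow> real"
  shows "(\<Sum>j<n. \<Sum>i<j. (x i - x j)\<^sup>2) = real n * (\<Sum>i<n. (x i)\<^sup>2) - (\<Sum>i<n. x i)\<^sup>2"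
proof (induction n)
  case (Suc n)
  have "(\<Sum>i<n. (x i - x n)\<^sup>2) = (\<Sum>i<n. (x i)\<^sup>2) - 2 * x n * (\<Sum>i<n. x i) + real n * (x n)\<^sup>2"
    by (simp add: power2_diff sum.distrib sum_subtractf sum_distrib_left algebra_simps)
  with Suc show ?case
    by (simp add: power2_eq_square algebra_simps)
qed simp

lemma mdiam_le: "(\<And>x y. \<lbrakk>x \<in> A; y \<in> A\<rbrakk> \<Longrightarrow> d x y \<le> c) \<Longrightarrow> mdiam d A \<le> ennreal c"
  unfolding mdiam_def by (intro SUP_least ennreal_leI)

text \<open>
  A Kraft inequality, playing the role of the uniform measure on infinite words. The word is built
  greedily: the conditional weight \<open>f w\<close> of the words extending \<open>w\<close>, rescaled by \<open>k\<close> to the length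
  of \<open>w\<close>, is at least the mean of its values at the \<open>k\<close> one-letter extensions of \<open>w\<close>, hence can be
  kept below 1; a word that belongs to the family has conditional weight at least 1.
\<close>
lemma infinite_word_avoiding:
  fixes B :: "nat \<Rightarrow> nat list set" and m :: "nat \<Rightarrow> nat"
  assumes k: "0 < k" and fin: "\<And>n. finite (B n)" and len: "\<And>n v. v \<in> B n \<Longrightarrow> length v = m n"
    and less: "(\<Sum>n. ennreal (real (card (B n)) / real k ^ m n)) < 1"
  obtains \<omega> where "\<And>i. \<omega> i < k" "\<And>n. map \<omega> [0..<m n] \<notin> B n"
proof -
  define P where "P = (\<lambda>w n. {v \<in> B n. take (length w) v = w})"
  define f where "f = (\<lambda>w. \<Sum>n. ennreal (real (card (P w n)) * real k ^ length w / real k ^ m n))"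
  have finP: "finite (P w n)" for w n using fin by (simp add: P_def)
  have step: "\<exists>i<k. f (w @ [i]) < 1" if "f w < 1" for w
  proof (rule ccontr)
    assume "\<not> ?thesis"
    \<comment> \<open>Summing over the letters: the extensions of \<open>w\<close> by distinct letters are disjoint families.\<close>
    then have ge: "1 \<le> f (w @ [i])" if "i < k" for i using that by auto
    have "(\<Sum>i<k. real (card (P (w @ [i]) n)) * real k ^ length (w @ [i]) / real k ^ m n)
        \<le> real k * (real (card (P w n)) * real k ^ length w / real k ^ m n)" for n
    proof -
      have sub: "P (w @ [i]) n \<subseteq> P w n" for i
      proof
        fix v assume "v \<in> P (w @ [i]) n"
        then have "v \<in> B n" "take (length w + 1) v = w @ [i]" by (auto simp: P_def)
        then have "take (length w) (take (length w + 1) v) = w" by simp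
        then show "v \<in> P w n" using \<open>v \<in> B n\<close> by (simp add: P_def)
      qed
      have "(\<Sum>i<k. card (P (w @ [i]) n)) = card (\<Union>i<k. P (w @ [i]) n)"
      proof (rule card_UN_disjoint[symmetric])
        show "\<forall>i\<in>{..<k}. \<forall>j\<in>{..<k}. i \<noteq> j \<longrightarrow> P (w @ [i]) n \<inter> P (w @ [j]) n = {}"
          by (auto simp: P_def)
      qed (use finP in auto)
      also have "\<dots> \<le> card (P w n)"
        using finP sub by (intro card_mono) auto
      finally have "real (\<Sum>i<k. card (P (w @ [i]) n)) \<le> real (card (P w n))"
        by (rule of_nat_mono)
      then have "(\<Sum>i<k. real (card (P (w @ [i]) n))) * (real k ^ Suc (length w) / real k ^ m n)
          \<le> real (card (P w n)) * (real k ^ Suc (length w) / real k ^ m n)"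
        using k by (intro mult_right_mono) auto
      then show ?thesis
        by (simp add: sum_distrib_left sum_divide_distrib sum_distrib_right mult_ac)
    qed
    then have "(\<Sum>i<k. ennreal (real (card (P (w @ [i]) n)) * real k ^ length (w @ [i]) / real k ^ m n))
        \<le> ennreal (real k) * ennreal (real (card (P w n)) * real k ^ length w / real k ^ m n)" for n
      by (simp only: sum_ennreal ennreal_mult'[symmetric] ennreal_leI divide_nonneg_nonneg
          mult_nonneg_nonneg of_nat_0_le_iff zero_le_power)
    then have "(\<Sum>i<k. f (w @ [i])) \<le> (\<Sum>n. ennreal (real k) * ennreal (real (card (P w n)) * real k ^ length w / real k ^ m n))"
      unfolding f_def suminf_sum[OF summableI, symmetric]
      by (rule suminf_le[OF _ summableI summableI])
    also have "\<dots> = ennreal (real k) * f w"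
      unfolding f_def by (rule ennreal_suminf_cmult)
    also have "\<dots> < ennreal (real k) * 1"
      using that k by (intro ennreal_mult_strict_left_mono) auto
    finally have "(\<Sum>i<k. f (w @ [i])) < ennreal (real k)" by simp
    moreover have "(\<Sum>i<k. f (w @ [i])) \<ge> (\<Sum>i<k. 1)"
      using ge by (intro sum_mono) auto
    ultimately show False
      by (simp add: ennreal_of_nat_eq_real_of_nat)
  qed
  have "f [] < 1"
    using less by (simp add: f_def P_def)
  then obtain W where W0: "W 0 = []" and W: "\<And>n. f (W n) < 1"
    and WS: "\<And>n. \<exists>i<k. W (Suc n) = W n @ [i]"
    using dependent_nat_choice[of "\<lambda>n w. f w < 1 \<and> (n = 0 \<longrightarrow> w = [])" "\<lambda>n w w'. \<exists>i<k. w' = w @ [i]"] step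
    by (metis nat.simps(3))
  then obtain \<omega> where \<omega>: "\<And>n. \<omega> n < k" "\<And>n. W (Suc n) = W n @ [\<omega> n]"
    by metis
  have W_eq: "W n = map \<omega> [0..<n]" for n
    by (induction n) (simp_all add: W0 \<omega>)
  have "W (m n) \<notin> B n" for n
  proof
    assume "W (m n) \<in> B n"
    then have "W (m n) \<in> P (W (m n)) n" by (simp add: P_def)
    then have "1 \<le> card (P (W (m n)) n)"
      using finP[of "W (m n)" n] by (metis Suc_leI One_nat_def card_gt_0_iff empty_iff)
    then have "1 \<le> ennreal (real (card (P (W (m n)) n)) * real k ^ length (W (m n)) / real k ^ m n)"
      using k by (simp add: W_eq)
    also have "\<dots> = (\<Sum>n'\<in>{n}. ennreal (real (card (P (W (m n)) n')) * real k ^ length (W (m n)) / real k ^ m n'))"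
      by (simp only: sum.insert finite.emptyI empty_iff not_False_eq_True sum.empty add_0_right)
    also have "\<dots> \<le> f (W (m n))"
      unfolding f_def by (rule sum_le_suminf[OF summableI]) (simp_all only: finite.intros zero_le)
    finally show False using W[of "m n"] by simp
  qed
  with \<omega>(1) show thesis
    using that[of \<omega>] by (simp add: W_eq)
qed

section \<open>Barycentric coordinates and the contractions\<close>

locale simplex_fractal =
  fixes k :: nat and p :: "nat \<Rightarrow> 'a::euclidean_space"
  assumes k3: "3 \<le> k" and dim: "DIM('a) = k - 1" and reg: "regular_simplex k p"
begin

definition side :: real where "side = dist (p 0) (p 1)"

text \<open>
  The \<open>i\<close>-th barycentric coordinate. In a regular simplex it is an explicit combination of the squared
  distances to the vertices, which gives affinity, continuity and the values at the vertices by
  direct computation.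
\<close>
definition bary :: "nat \<Rightarrow> 'a \<Rightarrow> real" where
  "bary i x = 1 / real k + ((\<Sum>l<k. (dist x (p l))\<^sup>2) / real k - (dist x (p i))\<^sup>2) / side\<^sup>2"

lemma side_pos: "0 < side" and dist_vertices: "\<lbrakk>i < k; j < k; i \<noteq> j\<rbrakk> \<Longrightarrow> dist (p i) (p j) = side"
proof -
  obtain c where c: "c > 0" "\<And>i j. \<lbrakk>i < k; j < k; i \<noteq> j\<rbrakk> \<Longrightarrow> dist (p i) (p j) = c"
    using reg unfolding regular_simplex_def by blast
  have "side = c"
    unfolding side_def using c(2)[of 0 1] k3 by simp
  with c show "0 < side" "\<lbrakk>i < k; j < k; i \<noteq> j\<rbrakk> \<Longrightarrow> dist (p i) (p j) = side" by auto
qed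

lemma vertex_inj: "\<lbrakk>i < k; j < k; p i = p j\<rbrakk> \<Longrightarrow> i = j"
  using dist_vertices[of i j] side_pos by (cases "i = j") auto

lemma sum_if_vertex:
  fixes a b :: real
  assumes "j < k"
  shows "(\<Sum>l<k. if l = j then a else b) = a + (real k - 1) * b"
proof -
  have "(\<Sum>l<k. if l = j then a else b) = (\<Sum>l<k. b + (if l = j then a - b else 0))"
    by (intro sum.cong) auto
  also have "\<dots> = real k * b + (a - b)"
    using assms by (simp add: sum.distrib)
  finally show ?thesis by (simp add: algebra_simps)
qed

lemma bary_vertex:
  assumes "i < k" "j < k"
  shows "bary i (p j) = (if i = j then 1 else 0)"
proof -
  have "(\<Sum>l<k. (dist (p j) (p l))\<^sup>2) = (\<Sum>l<k. if l = j then 0 else side\<^sup>2)"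
    using assms dist_vertices by (intro sum.cong) auto
  also have "\<dots> = (real k - 1) * side\<^sup>2"
    using sum_if_vertex[OF assms(2)] by simp
  finally show ?thesis
    using assms side_pos k3 dist_vertices[of j i]
    by (auto simp: bary_def field_simps)
qed

lemma bary_sum: "(\<Sum>i<k. bary i x) = 1"
proof -
  have "(\<Sum>i<k. bary i x)
      = 1 + (\<Sum>i<k. ((\<Sum>l<k. (dist x (p l))\<^sup>2) / real k - (dist x (p i))\<^sup>2)) / side\<^sup>2"
    using k3 by (simp add: bary_def sum.distrib flip: sum_divide_distrib)
  also have "\<dots> = 1"
    using k3 by (simp add: sum_subtractf)
  finally show ?thesis .
qed

text \<open>
  The terms quadratic in the point cancel between the mean squared distance and the squared distance
  to the \<open>i\<close>-th vertex; what remains is affine.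
\<close>
lemma bary_inner: "\<exists>a b. \<forall>x. bary i x = a + x \<bullet> b"
proof -
  have d: "(dist x y)\<^sup>2 = x \<bullet> x - 2 * (x \<bullet> y) + y \<bullet> y" for x y :: 'a
    by (simp add: dist_norm power2_norm_eq_inner inner_diff inner_commute)
  have s: "(\<Sum>l<k. (dist x (p l))\<^sup>2) / real k
      = x \<bullet> x - 2 * (x \<bullet> (\<Sum>l<k. p l)) / k + (\<Sum>l<k. p l \<bullet> p l) / k" for x
    using k3 by (simp add: d sum.distrib sum_subtractf inner_sum_right field_simps
        flip: sum_distrib_left)
  have "bary i x = (1 / real k + ((\<Sum>l<k. p l \<bullet> p l) / k - p i \<bullet> p i) / side\<^sup>2)
     + x \<bullet> ((2 / side\<^sup>2) *\<^sub>R (p i - (1/k) *\<^sub>R (\<Sum>l<k. p l)))" for x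
    unfolding bary_def s unfolding d using side_pos k3
    by (simp add: field_simps inner_diff_right)
  then show ?thesis by blast
qed

lemma bary_affine:
  assumes "sum c {..<k} = 1"
  shows "bary i (\<Sum>j<k. c j *\<^sub>R y j) = (\<Sum>j<k. c j * bary i (y j))"
proof -
  obtain a b where ab: "\<And>x. bary i x = a + x \<bullet> b"
    using bary_inner by blast
  show ?thesis
    using assms by (simp add: ab inner_sum_left distrib_left sum.distrib flip: sum_distrib_right)
qed

text \<open>
  The \<open>k\<close> affinely independent vertices span the whole space, so every point is some affine
  combination of them; affinity of \<open>bary\<close> identifies the coefficients.
\<close>
lemma bary_expand: "x = (\<Sum>j<k. bary j x *\<^sub>R p j)"
proof -
  have inj: "inj_on p {..<k}" and indep: "\<not> affine_dependent (p ` {..<k})"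
    using reg by (auto simp: regular_simplex_def)
  have "card (p ` {..<k}) = Suc DIM('a)"
    using inj dim k3 by (simp add: card_image)
  then have "x \<in> affine hull (p ` {..<k})"
    using affine_independent_span_eq[OF indep] by simp
  then obtain u where u: "sum u (p ` {..<k}) = 1" "(\<Sum>v\<in>p ` {..<k}. u v *\<^sub>R v) = x"
    by (auto simp: affine_hull_finite)
  define c where "c = u \<circ> p"
  have c: "sum c {..<k} = 1" "(\<Sum>j<k. c j *\<^sub>R p j) = x"
    using u inj by (simp_all add: sum.reindex c_def)
  have "bary i x = c i" if "i < k" for i
  proof -
    have "bary i x = (\<Sum>j<k. c j * bary i (p j))"
      using bary_affine[OF c(1), of i p] c(2) by simp
    also have "\<dots> = (\<Sum>j<k. if j = i then c j else 0)"
      by (intro sum.cong) (use that in \<open>auto simp: bary_vertex\<close>)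
    finally show ?thesis
      using that by simp
  qed
  then have "(\<Sum>j<k. bary j x *\<^sub>R p j) = (\<Sum>j<k. c j *\<^sub>R p j)"
    by (intro sum.cong) auto
  with c(2) show ?thesis by simp
qed

lemma bary_eqI: "(\<And>j. j < k \<Longrightarrow> bary j x = bary j y) \<Longrightarrow> x = y"
  using bary_expand[of x] bary_expand[of y] by simp

lemma continuous_bary: "continuous_on S (bary i)"
  unfolding bary_def[abs_def] by (intro continuous_intros) (use k3 side_pos in auto)

lemma affine_map_bary:
  assumes "affine_map g"
  shows "g x = (\<Sum>j<k. bary j x *\<^sub>R g (p j))"
proof -
  obtain L b where L: "linear L" and g: "g = (\<lambda>x. L x + b)"
    using assms unfolding affine_map_def by blast
  have "g x = L (\<Sum>j<k. bary j x *\<^sub>R p j) + (\<Sum>j<k. bary j x) *\<^sub>R b"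
    using bary_expand[of x] by (simp add: g bary_sum)
  also have "\<dots> = (\<Sum>j<k. bary j x *\<^sub>R g (p j))"
    by (simp add: g linear_sum[OF L] linear_scale[OF L] scaleR_add_right sum.distrib
        scaleR_sum_left)
  finally show ?thesis .
qed

lemma affine_map_interpolate: "affine_map (\<lambda>x. \<Sum>j<k. bary j x *\<^sub>R t j)"
proof -
  have "\<forall>j. \<exists>a b. \<forall>x. bary j x = a + x \<bullet> b"
    using bary_inner by blast
  then obtain a b where ab: "\<And>j x. bary j x = a j + x \<bullet> b j"
    by metis
  have "linear (\<lambda>x. \<Sum>j<k. (x \<bullet> b j) *\<^sub>R t j)"
    by (intro linear_compose_sum ballI)
       (auto intro!: linearI simp: inner_add_left scaleR_add_left)
  then show ?thesis
    unfolding affine_map_def ab scaleR_add_left sum.distrib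
    by (intro exI[of _ "\<lambda>x. \<Sum>j<k. (x \<bullet> b j) *\<^sub>R t j"] exI[of _ "\<Sum>j<k. a j *\<^sub>R t j"])
       (simp add: add.commute)
qed

text \<open>
  An affine map is determined by its values at the vertices, so the definite description in the
  definition of \<open>F\<close> is met by interpolation in barycentric coordinates.
\<close>
lemma F_interpolate:
  assumes "i < k"
  shows "F k p i x = (\<Sum>j<k. bary j x *\<^sub>R (if j = i then p i else qpt k p j))"
proof -
  define g where "g = (\<lambda>x. \<Sum>j<k. bary j x *\<^sub>R (if j = i then p i else qpt k p j))"
  have vert: "g (p l) = (if l = i then p i else qpt k p l)" if "l < k" for l
  proof -
    have "g (p l) = (\<Sum>j<k. if j = l then (if j = i then p i else qpt k p j) else 0)"
      unfolding g_def by (intro sum.cong) (use that in \<open>auto simp: bary_vertex\<close>)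
    then show ?thesis using that by simp
  qed
  have "F k p i = g"
    unfolding F_def
  proof (rule the_equality)
    show "affine_map g \<and> g (p i) = p i \<and> (\<forall>j<k. j \<noteq> i \<longrightarrow> g (p j) = qpt k p j)"
      using vert assms affine_map_interpolate by (simp add: g_def)
  next
    fix h assume h: "affine_map h \<and> h (p i) = p i \<and> (\<forall>j<k. j \<noteq> i \<longrightarrow> h (p j) = qpt k p j)"
    show "h = g"
    proof
      fix x
      have "h x = (\<Sum>j<k. bary j x *\<^sub>R h (p j))"
        using h affine_map_bary by blast
      also have "\<dots> = g x"
        unfolding g_def by (intro sum.cong) (use h in auto)
      finally show "h x = g x" .
    qed
  qed
  then show ?thesis by (simp add: g_def)
qed

lemma F_fixed [simp]: "i < k \<Longrightarrow> F k p i (p i) = p i"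
  and F_vertex: "\<lbrakk>i < k; j < k; j \<noteq> i\<rbrakk> \<Longrightarrow> F k p i (p j) = qpt k p j"
proof -
  have *: "F k p i (p j) = (if j = i then p i else qpt k p j)" if "i < k" "j < k" for j
  proof -
    have "F k p i (p j) = (\<Sum>l<k. if l = j then (if l = i then p i else qpt k p l) else 0)"
      unfolding F_interpolate[OF that(1)]
      by (intro sum.cong) (use that in \<open>auto simp: bary_vertex\<close>)
    then show ?thesis using that by simp
  qed
  show "i < k \<Longrightarrow> F k p i (p i) = p i" using *[of i] by simp
  show "\<lbrakk>i < k; j < k; j \<noteq> i\<rbrakk> \<Longrightarrow> F k p i (p j) = qpt k p j" using *[of j] by simp
qed

lemma bary_qpt:
  assumes "m < k" "j < k"
  shows "bary m (qpt k p j) = (if m = j then 0 else 1 / (real k - 1))"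
proof -
  define c where "c = (\<lambda>l. if l = j then 0 else 1 / (real k - 1))"
  have c: "sum c {..<k} = 1"
    using sum_if_vertex[OF assms(2), of 0 "1 / (real k - 1)"] k3 by (simp add: c_def)
  have "qpt k p j = (\<Sum>l<k. c l *\<^sub>R p l)"
    using assms by (simp add: qpt_def c_def scaleR_sum_right if_distrib[of "\<lambda>a. a *\<^sub>R _"] sum.remove[of _ j] cong: if_cong)
  then have "bary m (qpt k p j) = (\<Sum>l<k. c l * bary m (p l))"
    using bary_affine[OF c, of m p] by simp
  also have "\<dots> = (\<Sum>l<k. if l = m then c l else 0)"
    by (intro sum.cong) (use assms in \<open>auto simp: bary_vertex\<close>)
  also have "\<dots> = c m" using assms by simp
  finally show ?thesis by (simp add: c_def)
qed

lemma bary_F: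
  assumes "i < k" "m < k"
  shows "bary m (F k p i x) =
    (if m = i then ((real k - 2) * bary i x + 1) / (real k - 1)
     else (1 - bary i x - bary m x) / (real k - 1))"
proof -
  have "bary m (F k p i x)
      = (\<Sum>j<k. bary j x * bary m (if j = i then p i else qpt k p j))"
    unfolding F_interpolate[OF assms(1)] by (rule bary_affine) (rule bary_sum)
  also have "\<dots> = (\<Sum>j<k. (1 / (real k - 1)) * bary j x
      + (if j = i then (if m = i then 1 else 0) * bary i x - bary i x / (real k - 1) else 0)
      - (if j = m then (if m = i then 0 else bary m x / (real k - 1)) else 0))"
    by (intro sum.cong) (use assms in \<open>auto simp: bary_vertex bary_qpt\<close>)
  also have "\<dots> = 1 / (real k - 1) + (if m = i then 1 else 0) * bary i x - bary i x / (real k - 1)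
      - (if m = i then 0 else bary m x / (real k - 1))"
    using assms by (simp add: sum.distrib sum_subtractf bary_sum flip: sum_distrib_left sum_divide_distrib)
  also have "\<dots> = (if m = i then ((real k - 2) * bary i x + 1) / (real k - 1)
     else (1 - bary i x - bary m x) / (real k - 1))"
  proof -
    define N where "N = real k - 1"
    have "real k - 2 = N - 1" "N \<noteq> 0" using k3 by (auto simp: N_def)
    then show ?thesis unfolding N_def[symmetric] by (simp add: field_simps)
  qed
  finally show ?thesis .
qed

text \<open>
  For coefficients with sum zero, only the part of the Gram matrix of the vertices that comes from
  the mutual distances contributes to the norm.
\<close>
lemma dist_bary: "(dist x y)\<^sup>2 = side\<^sup>2 / 2 * (\<Sum>j<k. (bary j x - bary j y)\<^sup>2)"
proof -
  define b where "b = (\<lambda>j. bary j x - bary j y)"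
  have b0: "sum b {..<k} = 0"
    by (simp add: b_def sum_subtractf bary_sum)
  have xy: "x - y = (\<Sum>j<k. b j *\<^sub>R p j)"
    using bary_expand[of x] bary_expand[of y]
    by (simp add: b_def scaleR_diff_left sum_subtractf)
  have ip: "p j \<bullet> p l = (p j \<bullet> p j) / 2 + (p l \<bullet> p l) / 2 - side\<^sup>2 / 2 + (if l = j then side\<^sup>2 / 2 else 0)"
    if "j < k" "l < k" for j l
  proof -
    have "(dist (p j) (p l))\<^sup>2 = p j \<bullet> p j - 2 * (p j \<bullet> p l) + p l \<bullet> p l"
      by (simp add: dist_norm power2_norm_eq_inner inner_diff inner_commute)
    moreover have "(dist (p j) (p l))\<^sup>2 = (if l = j then 0 else side\<^sup>2)"
      using dist_vertices[OF that] by auto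
    ultimately show ?thesis
      by (auto simp: diff_divide_distrib add_divide_distrib split: if_splits)
  qed
  have "(dist x y)\<^sup>2 = (\<Sum>j<k. \<Sum>l<k. b j * b l * (p j \<bullet> p l))"
    unfolding dist_norm power2_norm_eq_inner xy inner_sum_left
    unfolding inner_sum_right by (simp add: mult_ac)
  also have "\<dots> = (\<Sum>j<k. \<Sum>l<k. (b j * (p j \<bullet> p j / 2 - side\<^sup>2/2)) * b l
      + b j * (b l * (p l \<bullet> p l) / 2) + (if l = j then side\<^sup>2 / 2 * (b j)\<^sup>2 else 0))"
  proof (intro sum.cong refl)
    fix j l assume "j \<in> {..<k}" "l \<in> {..<k}"
    then show "b j * b l * (p j \<bullet> p l) = (b j * (p j \<bullet> p j / 2 - side\<^sup>2/2)) * b l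
        + b j * (b l * (p l \<bullet> p l) / 2) + (if l = j then side\<^sup>2 / 2 * (b j)\<^sup>2 else 0)"
      by (subst ip) (auto simp: algebra_simps power2_eq_square)
  qed
  also have "\<dots> = side\<^sup>2 / 2 * (\<Sum>j<k. (b j)\<^sup>2)"
    by (simp add: sum.distrib b0 flip: sum_distrib_left sum_distrib_right sum_divide_distrib)
  finally show ?thesis by (simp add: b_def)
qed

text \<open>
  In barycentric coordinates, the differences \<open>b\<^sub>j\<close> of two points become \<open>(k - 2) b\<^sub>i / (k - 1)\<close>
  and \<open>- (b\<^sub>i + b\<^sub>m) / (k - 1)\<close> for \<open>m \<noteq> i\<close>. Since the \<open>b\<^sub>j\<close> have sum zero, Cauchy-Schwarz
  bounds \<open>b\<^sub>i\<^sup>2\<close> by \<open>k - 1\<close> times the sum of the other squares.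
\<close>
lemma F_contraction:
  assumes "i < k"
  shows "dist (F k p i x) (F k p i y) \<le> (real k - 2) / (real k - 1) * dist x y"
proof -
  define n where "n = real k"
  have n: "n \<ge> 3" using k3 by (simp add: n_def)
  define b where "b = (\<lambda>j. bary j x - bary j y)"
  define T where "T = (\<Sum>j\<in>{..<k}-{i}. (b j)\<^sup>2)"
  have split: "(\<Sum>j<k. g j) = g i + (\<Sum>j\<in>{..<k}-{i}. g j)" for g :: "nat \<Rightarrow> real"
    using assms by (simp add: sum.remove)
  have "sum b {..<k} = 0"
    by (simp add: b_def sum_subtractf bary_sum)
  then have b0: "(\<Sum>j\<in>{..<k}-{i}. b j) = - b i"
    by (simp add: split)
  have cardi: "real (card ({..<k}-{i})) = n - 1"
    using assms k3 by (simp add: n_def)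
  have cs: "(b i)\<^sup>2 \<le> (n - 1) * T"
    using Cauchy_Schwarz_ineq_sum[of "\<lambda>_. 1" b "{..<k}-{i}"] cardi
    by (simp add: b0 T_def del: card_Diff_insert)
  have diff: "bary m (F k p i x) - bary m (F k p i y)
      = (if m = i then (n - 2) * b i else - (b i + b m)) / (n - 1)" if "m < k" for m
    using assms that
    by (simp add: bary_F b_def flip: n_def diff_divide_distrib) (simp add: algebra_simps)
  have "(\<Sum>m<k. (bary m (F k p i x) - bary m (F k p i y))\<^sup>2)
      = (\<Sum>m<k. (if m = i then (n - 2)\<^sup>2 * (b i)\<^sup>2 else (b i + b m)\<^sup>2) / (n - 1)\<^sup>2)"
    by (intro sum.cong) (auto simp: diff power_divide power_mult_distrib power2_eq_square algebra_simps)
  also have "\<dots> = ((n - 2)\<^sup>2 * (b i)\<^sup>2 + (\<Sum>m\<in>{..<k}-{i}. (b i + b m)\<^sup>2)) / (n - 1)\<^sup>2"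
    by (simp add: split flip: sum_divide_distrib)
  also have "(\<Sum>m\<in>{..<k}-{i}. (b i + b m)\<^sup>2) = (n - 3) * (b i)\<^sup>2 + T"
  proof -
    have "(\<Sum>m\<in>{..<k}-{i}. (b i + b m)\<^sup>2)
        = (\<Sum>m\<in>{..<k}-{i}. (b i)\<^sup>2) + 2 * b i * (\<Sum>m\<in>{..<k}-{i}. b m) + T"
      by (simp add: power2_sum sum.distrib T_def sum_distrib_left)
    also have "\<dots> = (n - 1) * (b i)\<^sup>2 - 2 * (b i)\<^sup>2 + T"
      by (simp only: sum_constant cardi b0) (simp add: power2_eq_square)
    finally show ?thesis by (simp add: algebra_simps)
  qed
  also have "((n - 2)\<^sup>2 * (b i)\<^sup>2 + ((n - 3) * (b i)\<^sup>2 + T)) \<le> (n - 2)\<^sup>2 * ((b i)\<^sup>2 + T)"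
  proof -
    have "(n - 3) * (b i)\<^sup>2 \<le> (n - 3) * ((n - 1) * T)"
      using cs n by (intro mult_left_mono) auto
    then show ?thesis by (simp add: algebra_simps power2_eq_square)
  qed
  also have "(b i)\<^sup>2 + T = (\<Sum>j<k. (b j)\<^sup>2)"
    by (simp add: split T_def)
  finally have "(\<Sum>m<k. (bary m (F k p i x) - bary m (F k p i y))\<^sup>2)
      \<le> ((n - 2) / (n - 1))\<^sup>2 * (\<Sum>j<k. (b j)\<^sup>2)"
    using n by (simp add: power_divide divide_right_mono)
  from mult_left_mono[OF this, of "side\<^sup>2 / 2"]
  have "(dist (F k p i x) (F k p i y))\<^sup>2 \<le> side\<^sup>2 / 2 * (((n - 2) / (n - 1))\<^sup>2 * (\<Sum>j<k. (b j)\<^sup>2))"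
    by (simp only: dist_bary) simp
  also have "\<dots> = ((n - 2) / (n - 1) * dist x y)\<^sup>2"
    by (simp only: power_mult_distrib dist_bary[of x y] b_def mult.left_commute)
  finally have "(dist (F k p i x) (F k p i y))\<^sup>2 \<le> ((n - 2) / (n - 1) * dist x y)\<^sup>2" .
  then show ?thesis
    unfolding n_def[symmetric] by (rule power2_le_imp_le) (use n in simp)
qed

lemma continuous_F: "i < k \<Longrightarrow> continuous_on S (F k p i)"
proof -
  assume i: "i < k"
  have "F k p i = (\<lambda>x. \<Sum>j<k. bary j x *\<^sub>R (if j = i then p i else qpt k p j))"
    using F_interpolate[OF i] by auto
  then show ?thesis
    by (auto intro!: continuous_intros continuous_bary)
qed

lemma F_inj: 
  assumes "i < k" "F k p i x = F k p i y" 
  shows "x = y"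
proof (rule bary_eqI)
  fix j assume j: "j < k"
  have "bary i (F k p i x) = bary i (F k p i y)" "bary j (F k p i x) = bary j (F k p i y)"
    using assms by auto
  then show "bary j x = bary j y"
    using assms(1) j k3 by (auto simp: bary_F divide_cancel_right split: if_splits)
qed

section \<open>The self-similar set\<close>

text \<open>
  The convex hull of the vertices.
\<close>
definition solid :: "'a set" where "solid = {x. \<forall>j<k. 0 \<le> bary j x}"

lemma vertex_solid: "j < k \<Longrightarrow> p j \<in> solid"
  by (auto simp: solid_def bary_vertex)

lemma bary_pair_le:
  assumes "x \<in> solid" "i < k" "m < k" "i \<noteq> m"
  shows "bary i x + bary m x \<le> 1"
proof -
  have "(\<Sum>j\<in>{i, m}. bary j x) \<le> (\<Sum>j<k. bary j x)"
    using assms by (intro sum_mono2) (auto simp: solid_def)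
  then show ?thesis
    using assms by (simp add: bary_sum)
qed

lemma F_solid:
  assumes "i < k" "x \<in> solid"
  shows "F k p i x \<in> solid"
  unfolding solid_def
proof (clarify)
  fix m assume "m < k"
  then show "0 \<le> bary m (F k p i x)"
    using assms bary_pair_le[OF assms(2,1) \<open>m < k\<close>] k3
    by (auto simp: bary_F solid_def)
qed

lemma F_eq_vertex:
  assumes "i < k" "j < k" "x \<in> solid" "F k p i x = p j"
  shows "i = j \<and> x = p j"
proof -
  have "bary i (p j) > 0"
    using assms k3 by (auto simp: bary_F solid_def simp flip: assms(4) intro!: divide_pos_pos add_nonneg_pos)
  then have "i = j"
    using assms by (simp add: bary_vertex split: if_splits)
  with assms F_inj[of i x "p i"] show ?thesis by simp
qed

text \<open>
  Comparing the \<open>i\<close>-th coordinates of the two images gives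
  \<open>(k - 2) bary i x = - bary l y - bary i y\<close>, where all coordinates are nonnegative.
\<close>
lemma F_overlap:
  assumes il: "i < k" "l < k" "i \<noteq> l" and x: "x \<in> solid" and y: "y \<in> solid"
    and eq: "F k p i x = F k p l y"
  shows "x = y" "bary i x = 0" "bary l x = 0"
proof -
  have k0: "real k - 1 \<noteq> 0" using k3 by simp
  have zeros: "bary i x = 0 \<and> bary l y = 0 \<and> bary i y = 0"
    if "i < k" "l < k" "i \<noteq> l" "x \<in> solid" "y \<in> solid" "F k p i x = F k p l y" for i l x y
  proof -
    have "bary i (F k p i x) = bary i (F k p l y)"
      using that by simp
    then have "(real k - 2) * bary i x + 1 = 1 - bary l y - bary i y"
      using that(1-3) k0 by (simp add: bary_F)
    moreover have "0 \<le> bary i x" "0 \<le> bary l y" "0 \<le> bary i y"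
      using that by (auto simp: solid_def)
    moreover have "(real k - 2) * bary i x \<ge> bary i x"
      using \<open>0 \<le> bary i x\<close> k3 mult_right_mono[of 1 "real k - 2" "bary i x"] by simp
    ultimately show ?thesis by linarith
  qed
  have z: "bary i x = 0" "bary l y = 0" "bary i y = 0" "bary l x = 0"
    using zeros[OF il x y eq] zeros[OF il(2,1) il(3)[symmetric] y x eq[symmetric]] by auto
  then show "bary i x = 0" "bary l x = 0" by auto
  show "x = y"
  proof (rule bary_eqI)
    fix m assume m: "m < k"
    have "bary m (F k p i x) = bary m (F k p l y)"
      using eq by simp
    then show "bary m x = bary m y"
      using z il m k0 by (cases "m = i"; cases "m = l") (auto simp: bary_F)
  qed
qed

text \<open>
  The \<open>m\<close>-th coordinate of \<open>F\<^sub>s(x)\<close> is positive for \<open>m = s\<close>, and for other \<open>m\<close> it vanishes only if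
  \<open>x\<close> lies on the edge from \<open>p\<^sub>s\<close> to \<open>p\<^sub>m\<close>. Two zeros place \<open>x\<close> on two
  edges, which meet only at \<open>p\<^sub>s\<close>, and \<open>p\<^sub>s\<close> is fixed by \<open>F\<^sub>s\<close>.
\<close>
lemma two_zero_coordinates:
  assumes s: "s < k" and x: "x \<in> solid" and il: "i < k" "l < k" "i \<noteq> l"
    and 0: "bary i (F k p s x) = 0" "bary l (F k p s x) = 0"
  shows "s \<noteq> i" "s \<noteq> l" "F k p s x = p s"
proof -
  have k0: "real k - 1 \<noteq> 0" using k3 by simp
  have pos: "bary s (F k p s x) > 0"
    using s x k3 by (auto simp: bary_F solid_def intro!: divide_pos_pos add_nonneg_pos)
  with 0 show si: "s \<noteq> i" "s \<noteq> l" by auto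
  have i: "bary s x + bary i x = 1" and l: "bary s x + bary l x = 1"
    using 0 si s il k0 by (auto simp: bary_F)
  have "(\<Sum>j\<in>{s, i, l}. bary j x) \<le> (\<Sum>j<k. bary j x)"
    using s il x by (intro sum_mono2) (auto simp: solid_def)
  then have "bary s x + bary i x + bary l x \<le> 1"
    using si il by (simp add: bary_sum)
  then have s1: "bary s x = 1"
    using i l x il by (auto simp: solid_def)
  have "x = p s"
  proof (rule bary_eqI)
    fix j assume "j < k"
    then show "bary j x = bary j (p s)"
      using bary_pair_le[OF x s, of j] s1 x s by (force simp: bary_vertex solid_def)
  qed
  with s show "F k p s x = p s" by simp
qed

lemma closed_solid: "closed solid"
proof -
  have "solid = (\<Inter>j<k. {x. 0 \<le> bary j x})"
    by (auto simp: solid_def)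
  moreover have "closed {x. 0 \<le> bary j x}" for j
    using continuous_bary by (intro closed_Collect_le) auto
  ultimately show ?thesis by (auto intro: closed_INT)
qed

lemma bounded_solid: "bounded solid"
  unfolding bounded_iff
proof (intro exI ballI)
  fix x assume x: "x \<in> solid"
  have "norm x = norm (\<Sum>j<k. bary j x *\<^sub>R p j)"
    using bary_expand[of x] by simp
  also have "\<dots> \<le> (\<Sum>j<k. norm (bary j x *\<^sub>R p j))"
    by (rule norm_sum)
  also have "\<dots> \<le> (\<Sum>j<k. 1 * norm (p j))"
  proof (rule sum_mono)
    fix j assume j: "j \<in> {..<k}"
    have "bary j x \<le> (\<Sum>j<k. bary j x)"
      using x j by (intro member_le_sum) (auto simp: solid_def)
    then show "norm (bary j x *\<^sub>R p j) \<le> 1 * norm (p j)"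
      using x j unfolding norm_scaleR by (intro mult_right_mono) (auto simp: bary_sum solid_def)
  qed
  finally show "norm x \<le> (\<Sum>j<k. 1 * norm (p j))" .
qed

lemma V_mono: "V k p m \<subseteq> V k p (Suc m)"
proof (induction m)
  case 0
  show ?case
  proof
    fix x assume "x \<in> V k p 0"
    then obtain j where "j < k" "x = p j" by auto
    then show "x \<in> V k p (Suc 0)"
      using F_fixed[of j] by (auto intro!: bexI[of _ j] rev_image_eqI[of "p j"])
  qed
next
  case (Suc m)
  then have "F k p i ` V k p m \<subseteq> F k p i ` V k p (Suc m)" for i
    by (rule image_mono)
  then show ?case
    unfolding V.simps(2)[of k p "Suc m"] V.simps(2)[of k p m] by (intro UN_mono) auto
qed

lemma V_subset_Vstar: "V k p m \<subseteq> Vstar k p"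
  by (auto simp: Vstar_def)

lemma vertex_Vstar: "j < k \<Longrightarrow> p j \<in> Vstar k p"
  using V_subset_Vstar[of 0] by auto

lemma Vstar_invariant: "Vstar k p = (\<Union>i<k. F k p i ` Vstar k p)"
proof -
  have "Vstar k p = (\<Union>m. V k p (Suc m))"
    unfolding Vstar_def using V_mono by blast
  also have "\<dots> = (\<Union>i<k. F k p i ` Vstar k p)"
    by (auto simp: Vstar_def)
  finally show ?thesis .
qed

lemma F_Vstar: "\<lbrakk>i < k; x \<in> Vstar k p\<rbrakk> \<Longrightarrow> F k p i x \<in> Vstar k p"
  using Vstar_invariant by blast

lemma Vstar_induct [consumes 1, case_names vertex cell]:
  assumes "x \<in> Vstar k p"
    and "\<And>j. j < k \<Longrightarrow> P (p j)"
    and "\<And>i y. \<lbrakk>i < k; y \<in> Vstar k p; P y\<rbrakk> \<Longrightarrow> P (F k p i y)"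
  shows "P x"
proof -
  have "x \<in> V k p m \<Longrightarrow> P x" for m x
  proof (induction m arbitrary: x)
    case (Suc m)
    then obtain i y where y: "i < k" "y \<in> V k p m" "x = F k p i y" by auto
    moreover have "y \<in> Vstar k p" using y V_subset_Vstar by blast
    ultimately show ?case using assms(3) Suc.IH by blast
  qed (use assms(2) in auto)
  then show ?thesis
    using assms(1) by (auto simp: Vstar_def)
qed

lemma Vstar_solid: "x \<in> Vstar k p \<Longrightarrow> x \<in> solid"
  by (induction rule: Vstar_induct) (auto intro: vertex_solid F_solid)

lemma compact_closure_Vstar: "compact (closure (Vstar k p))"
  using bounded_solid Vstar_solid by (auto simp: compact_closure intro: bounded_subset)

lemma closure_Vstar_invariant: "closure (Vstar k p) = (\<Union>i<k. F k p i ` closure (Vstar k p))"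
proof -
  have "F k p i ` closure (Vstar k p) = closure (F k p i ` Vstar k p)" if "i < k" for i
  proof
    show "F k p i ` closure (Vstar k p) \<subseteq> closure (F k p i ` Vstar k p)"
      by (rule image_closure_subset)
         (auto intro: continuous_F that closure_subset[THEN subsetD])
    have "compact (F k p i ` closure (Vstar k p))"
      by (intro compact_continuous_image continuous_F that compact_closure_Vstar)
    then show "closure (F k p i ` Vstar k p) \<subseteq> F k p i ` closure (Vstar k p)"
      by (intro closure_minimal image_mono closure_subset compact_imp_closed)
  qed
  then have "(\<Union>i<k. F k p i ` closure (Vstar k p)) = (\<Union>i<k. closure (F k p i ` Vstar k p))"
    by auto
  also have "\<dots> = closure (\<Union>i<k. F k p i ` Vstar k p)"
  proof
    show "(\<Union>i<k. closure (F k p i ` Vstar k p)) \<subseteq> closure (\<Union>i<k. F k p i ` Vstar k p)"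
      by (intro UN_least closure_mono UN_upper)
    show "closure (\<Union>i<k. F k p i ` Vstar k p) \<subseteq> (\<Union>i<k. closure (F k p i ` Vstar k p))"
      by (intro closure_minimal UN_mono closure_subset closed_UN) auto
  qed
  finally show ?thesis
    using Vstar_invariant by simp
qed

text \<open>
  The point of \<open>S\<close> farthest from \<open>T\<close> is the image of a point of \<open>S\<close> under a contraction that maps
  \<open>T\<close> into itself, so its distance from \<open>T\<close> must be zero.
\<close>
lemma invariant_compact_subset:
  assumes "compact S" "S \<noteq> {}" "S = (\<Union>i<k. F k p i ` S)"
    and "compact T" "T \<noteq> {}" "T = (\<Union>i<k. F k p i ` T)"
  shows "S \<subseteq> T"
proof -
  have "continuous_on S (\<lambda>x. infdist x T)"
    by (intro continuous_intros)
  then obtain x where x: "x \<in> S" and max: "\<And>y. y \<in> S \<Longrightarrow> infdist y T \<le> infdist x T"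
    using continuous_attains_sup[OF assms(1,2)] by metis
  obtain i y where i: "i < k" "y \<in> S" "x = F k p i y"
    using x assms(3) by blast
  obtain t where t: "t \<in> T" "infdist y T = dist y t"
    using infdist_attains_inf[of T y] assms(4,5) compact_imp_closed by metis
  have "F k p i t \<in> T"
    using assms(6) t(1) i(1) by blast
  then have "infdist x T \<le> dist (F k p i y) (F k p i t)"
    unfolding i(3) by (rule infdist_le)
  also have "\<dots> \<le> (real k - 2) / (real k - 1) * infdist y T"
    using F_contraction[OF i(1)] by (simp add: t(2))
  also have "\<dots> \<le> (real k - 2) / (real k - 1) * infdist x T"
    using k3 max[OF i(2)] by (intro mult_left_mono) auto
  finally have "infdist x T * (1 / (real k - 1)) \<le> 0"
    using k3 by (simp add: field_simps)
  then have "infdist x T \<le> 0"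
    using k3 by (simp add: divide_le_0_iff)
  then have "infdist y T = 0" if "y \<in> S" for y
    using max[OF that] infdist_nonneg[of y T] by linarith
  then show ?thesis
    using assms(4,5) in_closed_iff_infdist_zero[of T] compact_imp_closed[of T] by auto
qed

text \<open>
  The closure of \<open>V\<^sub>*\<close> is itself invariant, which shows existence of the invariant set together with
  density of \<open>V\<^sub>*\<close> in it.
\<close>
theorem K_eq_closure: "K k p = closure (Vstar k p)"
  unfolding K_def
proof (rule the_equality)
  have ne: "closure (Vstar k p) \<noteq> {}"
    using vertex_Vstar[of 0] k3 by auto
  then show "closure (Vstar k p) \<noteq> {} \<and> compact (closure (Vstar k p)) \<and>
      closure (Vstar k p) = (\<Union>i<k. F k p i ` closure (Vstar k p))"
    using compact_closure_Vstar closure_Vstar_invariant by blast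
  fix S assume "S \<noteq> {} \<and> compact S \<and> S = (\<Union>i<k. F k p i ` S)"
  then show "S = closure (Vstar k p)"
    using invariant_compact_subset ne compact_closure_Vstar closure_Vstar_invariant
    by (meson subset_antisym)
qed

lemma compact_K: "compact (K k p)"
  and K_invariant: "K k p = (\<Union>i<k. F k p i ` K k p)"
  and Vstar_subset_K: "Vstar k p \<subseteq> K k p"
  using compact_closure_Vstar closure_Vstar_invariant closure_subset[of "Vstar k p"]
  by (simp_all add: K_eq_closure)

lemma K_solid: "x \<in> K k p \<Longrightarrow> x \<in> solid"
  using closure_minimal[OF subsetI[OF Vstar_solid] closed_solid] by (auto simp: K_eq_closure)

text \<open>
  Finite ramification: distinct cells of the first level meet only at the points \<open>q\<^sub>j\<close>. Membership
  in \<open>K\<close> matters: for \<open>k \<ge> 4\<close> the convex hulls of two cells share more than these points.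
\<close>
lemma F_overlap_K:
  assumes "i < k" "l < k" "i \<noteq> l" "x \<in> K k p" "y \<in> K k p" "F k p i x = F k p l y"
  obtains j where "j < k" "j \<noteq> i" "j \<noteq> l" "x = p j" "y = p j"
proof -
  have xs: "x \<in> solid" and ys: "y \<in> solid" using assms K_solid by auto
  note o = F_overlap[OF assms(1-3) xs ys assms(6)]
  obtain s x' where s: "s < k" "x' \<in> K k p" "x = F k p s x'"
    using K_invariant assms(4) by blast
  have "bary i (F k p s x') = 0" "bary l (F k p s x') = 0" using o s by auto
  from two_zero_coordinates[OF s(1) K_solid[OF s(2)] assms(1-3) this]
  show ?thesis using that[of s] s o(1) by auto
qed

section \<open>Cells\<close>

definition words :: "nat \<Rightarrow> nat list set" where
  "words m = {w. set w \<subseteq> {..<k} \<and> length w = m}"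

definition Fw :: "nat list \<Rightarrow> 'a \<Rightarrow> 'a" where
  "Fw = foldr (F k p)"

lemma Fw_Nil [simp]: "Fw [] x = x"
  and Fw_Cons [simp]: "Fw (i # w) x = F k p i (Fw w x)"
  by (simp_all add: Fw_def)

lemma Fw_append: "Fw (v @ w) x = Fw v (Fw w x)"
  by (induction v) auto

lemma words_0 [simp]: "words 0 = {[]}"
  by (auto simp: words_def)

lemma finite_words [simp, intro]: "finite (words m)"
  unfolding words_def by (rule finite_lists_length_eq) simp

lemma card_words: "card (words m) = k ^ m"
  unfolding words_def by (subst card_lists_length_eq) auto

lemma words_Suc: "words (Suc m) = (\<lambda>(i, w). i # w) ` ({..<k} \<times> words m)"
  by (auto simp: words_def length_Suc_conv image_iff)

lemma sum_words_Suc: "(\<Sum>w\<in>words (Suc m). g w) = (\<Sum>i<k. \<Sum>w\<in>words m. g (i # w))"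
  unfolding words_Suc
  by (subst sum.reindex) (auto simp: inj_on_def sum.cartesian_product split_def)

lemma Fw_Vstar: "\<lbrakk>w \<in> words m; x \<in> Vstar k p\<rbrakk> \<Longrightarrow> Fw w x \<in> Vstar k p"
  by (induction w arbitrary: m) (auto simp: words_def intro: F_Vstar)

lemma Fw_K: "\<lbrakk>w \<in> words m; x \<in> K k p\<rbrakk> \<Longrightarrow> Fw w x \<in> K k p"
  using K_invariant by (induction w arbitrary: m) (auto simp: words_def)

lemma continuous_Fw: "w \<in> words m \<Longrightarrow> continuous_on S (Fw w)"
proof (induction w arbitrary: m)
  case Nil
  have "Fw [] = id" by (auto simp: fun_eq_iff)
  then show ?case by simp
next
  case (Cons i w)
  then have "i < k" and "w \<in> words (m - 1)" by (auto simp: words_def)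
  moreover have "Fw (i # w) = F k p i \<circ> Fw w" by (auto simp: fun_eq_iff)
  ultimately show ?case
    using Cons.IH continuous_on_compose continuous_F by metis
qed

lemma cells_Suc:
  "(\<Union>w\<in>words (Suc m). Fw w ` A) = (\<Union>i<k. F k p i ` (\<Union>w\<in>words m. Fw w ` A))"
  by (auto simp: words_Suc intro!: bexI imageI UN_I)

lemma K_cells: "K k p = (\<Union>w\<in>words m. Fw w ` K k p)"
  by (induction m) (simp, simp only: cells_Suc flip: K_invariant)

lemma Vstar_cells: "Vstar k p = (\<Union>w\<in>words m. Fw w ` Vstar k p)"
  by (induction m) (simp, simp only: cells_Suc flip: Vstar_invariant)

lemma Fw_eq_vertex:
  assumes "w \<in> words m" "j < k" "x \<in> K k p" "Fw w x = p j"
  shows "w = replicate m j \<and> x = p j"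
  using assms
proof (induction m arbitrary: w)
  case (Suc m)
  then obtain i v where w: "w = i # v" "i < k" "v \<in> words m"
    by (auto simp: words_Suc)
  have "F k p i (Fw v x) = p j" "Fw v x \<in> K k p"
    using Suc.prems w Fw_K by auto
  then have "i = j \<and> Fw v x = p j"
    using F_eq_vertex K_solid w(2) Suc.prems(2) by blast
  then show ?case
    using Suc.IH[OF w(3)] Suc.prems w by simp
qed auto

text \<open>
  Cells of equal level inherit finite ramification: at the first letter where the words differ,
  \<open>F_overlap_K\<close> yields a vertex, and a vertex has only one address.
\<close>
lemma cells_meet:
  assumes "v \<in> words m" "w \<in> words m" "v \<noteq> w" "x \<in> K k p" "y \<in> K k p" "Fw v x = Fw w y"
  shows "x \<in> p ` {..<k} \<and> y \<in> p ` {..<k}"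
  using assms
proof (induction m arbitrary: v w)
  case (Suc m)
  obtain i v' where v: "v = i # v'" "i < k" "v' \<in> words m"
    using Suc.prems(1) by (auto simp: words_Suc)
  obtain l w' where w: "w = l # w'" "l < k" "w' \<in> words m"
    using Suc.prems(2) by (auto simp: words_Suc)
  have K: "Fw v' x \<in> K k p" "Fw w' y \<in> K k p"
    using Fw_K v w Suc.prems by auto
  have eq: "F k p i (Fw v' x) = F k p l (Fw w' y)"
    using Suc.prems v w by simp
  show ?case
  proof (cases "i = l")
    case True
    then show ?thesis
      using Suc.IH[OF v(3) w(3)] F_inj[OF v(2)] eq v w Suc.prems by auto
  next
    case False
    obtain j where j: "j < k" "Fw v' x = p j" "Fw w' y = p j"
      using F_overlap_K[OF v(2) w(2) False K eq] by metis
    then show ?thesis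
      using Fw_eq_vertex[OF v(3) j(1) Suc.prems(4)] Fw_eq_vertex[OF w(3) j(1) Suc.prems(5)] by auto
  qed
qed auto

section \<open>Monotonicity of the energies\<close>

text \<open>
  The denominator of \<open>r\<close>; the minimizing extension of \<open>u\<close> from \<open>V\<^sub>0\<close> to \<open>V\<^sub>1\<close> has it as denominator,
  too.
\<close>
definition D :: real where "D = (real k)\<^sup>2 - real k - 1"

lemma D_pos: "D \<ge> 1"
proof -
  have "real k * (real k - 1) \<ge> 3 * 2" using k3 by (intro mult_mono) auto
  then show ?thesis by (simp add: D_def power2_eq_square algebra_simps)
qed

abbreviation r :: real where "r \<equiv> renorm k"

lemma r_eq: "r = real k * (real k - 2) / D"
  by (simp add: renorm_def D_def)

lemma r_pos: "0 < r"
  unfolding r_eq using k3 D_pos by (intro divide_pos_pos mult_pos_pos) auto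

lemma r_less_1: "r < 1"
  unfolding r_eq using k3 D_pos by (simp add: D_def power2_eq_square algebra_simps)

lemma energy_0: "energy_level k p 0 u = real k * (\<Sum>j<k. (u (p j))\<^sup>2) - (\<Sum>j<k. u (p j))\<^sup>2"
  unfolding energy_level.simps by (rule sum_pairs_sq_diff[of "\<lambda>i. u (p i)"])

lemma energy_level_nonneg: "0 \<le> energy_level k p m u"
  by (induction m arbitrary: u)
     (use r_pos in \<open>auto intro!: sum_nonneg mult_nonneg_nonneg simp: less_imp_le\<close>)

lemma energy_level_cong:
  "(\<And>x. x \<in> V k p m \<Longrightarrow> u x = v x) \<Longrightarrow> energy_level k p m u = energy_level k p m v"
proof (induction m arbitrary: u v)
  case 0
  then show ?case by (simp add: energy_0)
next
  case (Suc m)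
  have "energy_level k p m (u \<circ> F k p i) = energy_level k p m (v \<circ> F k p i)" if "i < k" for i
    using that by (intro Suc.IH) (auto intro!: Suc.prems bexI imageI)
  then show ?case by simp
qed

lemma energy_level_affine: "energy_level k p m (\<lambda>x. a * u x + b) = a\<^sup>2 * energy_level k p m u"
proof (induction m arbitrary: u)
  case 0
  have "(a * s + b - (a * t + b))\<^sup>2 = a\<^sup>2 * (s - t)\<^sup>2" for s t
    by (simp add: power2_eq_square algebra_simps)
  then show ?case by (simp add: sum_distrib_left)
next
  case (Suc m)
  show ?case
    using Suc[of "u \<circ> F k p _"] by (simp add: o_def sum_distrib_left mult.left_commute)
qed

lemma energy_level_words:
  "energy_level k p (m + n) u = inverse r ^ m * (\<Sum>w\<in>words m. energy_level k p n (u \<circ> Fw w))"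
proof (induction m arbitrary: u)
  case 0
  have "u \<circ> Fw [] = u" by auto
  then show ?case by simp
next
  case (Suc m)
  have "(u \<circ> F k p i) \<circ> Fw w = u \<circ> Fw (i # w)" for i w by auto
  then show ?case
    by (simp add: Suc sum_words_Suc sum_distrib_left mult.assoc)
qed

lemma energy_level_Fw:
  assumes "w \<in> words m"
  shows "energy_level k p n (u \<circ> Fw w) \<le> r ^ m * energy_level k p (m + n) u"
proof -
  have "energy_level k p n (u \<circ> Fw w) \<le> (\<Sum>w\<in>words m. energy_level k p n (u \<circ> Fw w))"
    using assms by (intro member_le_sum) (auto intro: energy_level_nonneg)
  also have "\<dots> = r ^ m * energy_level k p (m + n) u"
    using r_pos by (simp add: energy_level_words power_inverse)
  finally show ?thesis .
qed

text \<open>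
  Here \<open>x\<^sub>i\<close> is the value at \<open>p\<^sub>i\<close> and \<open>y\<^sub>j\<close> the value at \<open>q\<^sub>j\<close>, so that \<open>z i\<close> lists the values on the
  \<open>i\<close>-th cell. The excess of the cell energies over the multiple of the energy on \<open>V\<^sub>0\<close> is a
  variance, that of the numbers \<open>x\<^sub>i + D y\<^sub>i\<close>, plus a multiple of \<open>(X - Y)\<^sup>2\<close>. It is nonnegative and
  vanishes exactly for \<open>y\<^sub>j = ((k - 1) X - x\<^sub>j) / D\<close>. This is what singles out the value of \<open>r\<close>.
\<close>
lemma cell_energy_identity:
  fixes x y :: "nat \<Rightarrow> real"
  defines "z \<equiv> \<lambda>i j. if j = i then x i else y j"
  defines "X \<equiv> (\<Sum>i<k. x i)" and "Y \<equiv> (\<Sum>i<k. y i)"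
  shows "D * (\<Sum>i<k. real k * (\<Sum>j<k. (z i j)\<^sup>2) - (\<Sum>j<k. z i j)\<^sup>2)
    = real k * (real k - 2) * (real k * (\<Sum>i<k. (x i)\<^sup>2) - X\<^sup>2)
      + ((\<Sum>i<k. (x i + D * y i)\<^sup>2) - (X + D * Y)\<^sup>2 / real k)
      + D * (real k - 1) / real k * (X - Y)\<^sup>2"
proof -
  define S where "S = (\<Sum>i<k. (x i)\<^sup>2)"
  define T where "T = (\<Sum>i<k. (y i)\<^sup>2)"
  define P where "P = (\<Sum>i<k. x i * y i)"
  have n: "real k \<noteq> 0" using k3 by simp
  have z1: "(\<Sum>j<k. z i j) = x i + Y - y i" and z2: "(\<Sum>j<k. (z i j)\<^sup>2) = (x i)\<^sup>2 + T - (y i)\<^sup>2"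
    if "i < k" for i
  proof -
    have "(\<Sum>j<k. z i j) = (\<Sum>j<k. y j + (if j = i then x i - y i else 0))"
      by (intro sum.cong) (auto simp: z_def)
    then show "(\<Sum>j<k. z i j) = x i + Y - y i"
      using that by (simp add: sum.distrib Y_def)
    have "(\<Sum>j<k. (z i j)\<^sup>2) = (\<Sum>j<k. (y j)\<^sup>2 + (if j = i then (x i)\<^sup>2 - (y i)\<^sup>2 else 0))"
      by (intro sum.cong) (auto simp: z_def)
    then show "(\<Sum>j<k. (z i j)\<^sup>2) = (x i)\<^sup>2 + T - (y i)\<^sup>2"
      using that by (simp add: sum.distrib T_def)
  qed
  have "(\<Sum>i<k. real k * (\<Sum>j<k. (z i j)\<^sup>2) - (\<Sum>j<k. z i j)\<^sup>2)
      = (\<Sum>i<k. (real k - 1) * (x i)\<^sup>2 + real k * T - (real k + 1) * (y i)\<^sup>2 + 2 * (x i * y i)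
          - 2 * Y * x i + 2 * Y * y i - Y\<^sup>2)"
  proof (intro sum.cong refl)
    fix i assume "i \<in> {..<k}"
    then have "i < k" by simp
    show "real k * (\<Sum>j<k. (z i j)\<^sup>2) - (\<Sum>j<k. z i j)\<^sup>2
      = (real k - 1) * (x i)\<^sup>2 + real k * T - (real k + 1) * (y i)\<^sup>2 + 2 * (x i * y i)
          - 2 * Y * x i + 2 * Y * y i - Y\<^sup>2"
      unfolding z1[OF \<open>i < k\<close>] z2[OF \<open>i < k\<close>] by algebra
  qed
  also have "\<dots> = (real k - 1) * S + real k * (real k * T) - (real k + 1) * T + 2 * P
          - 2 * Y * X + 2 * Y * Y - real k * Y\<^sup>2"
    unfolding sum.distrib sum_subtractf S_def T_def P_def X_def Y_def
    by (simp add: sum_distrib_left[symmetric])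
  also have "\<dots> = (real k - 1) * S + D * T + 2 * P - 2 * Y * X - (real k - 2) * Y\<^sup>2"
    by (simp add: D_def power2_eq_square algebra_simps)
  finally have A: "(\<Sum>i<k. real k * (\<Sum>j<k. (z i j)\<^sup>2) - (\<Sum>j<k. z i j)\<^sup>2) = \<dots>" .
  have B: "(\<Sum>i<k. (x i + D * y i)\<^sup>2) = S + 2 * D * P + D\<^sup>2 * T"
    unfolding S_def T_def P_def
    by (simp add: power2_sum power_mult_distrib sum.distrib sum_distrib_left algebra_simps)
  have "real k * (D * ((real k - 1) * S + D * T + 2 * P - 2 * Y * X - (real k - 2) * Y\<^sup>2))
    = real k * (real k * (real k - 2) * (real k * S - X\<^sup>2)
      + (S + 2 * D * P + D\<^sup>2 * T)) - (X + D * Y)\<^sup>2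
      + D * (real k - 1) * (X - Y)\<^sup>2"
    unfolding D_def by algebra
  then have "D * ((real k - 1) * S + D * T + 2 * P - 2 * Y * X - (real k - 2) * Y\<^sup>2)
    = (real k * (real k * (real k - 2) * (real k * S - X\<^sup>2)
      + (S + 2 * D * P + D\<^sup>2 * T)) - (X + D * Y)\<^sup>2
      + D * (real k - 1) * (X - Y)\<^sup>2) / real k"
    using n by (metis nonzero_mult_div_cancel_left)
  also have "\<dots> = real k * (real k - 2) * (real k * S - X\<^sup>2)
      + ((S + 2 * D * P + D\<^sup>2 * T) - (X + D * Y)\<^sup>2 / real k)
      + D * (real k - 1) / real k * (X - Y)\<^sup>2"
    using n by (simp only: add_divide_distrib diff_divide_distrib nonzero_mult_div_cancel_left
        times_divide_eq_left times_divide_eq_right) simp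
  finally show ?thesis
    unfolding A B S_def[symmetric] .
qed

lemma energy_level_1: "r * energy_level k p 1 u
  = (\<Sum>i<k. energy_level k p 0 (u \<circ> F k p i))"
  using r_pos by simp

lemma D_energy_1:
  assumes y: "\<And>i j. \<lbrakk>i < k; j < k; i \<noteq> j\<rbrakk> \<Longrightarrow> u (F k p i (p j)) = y j"
  shows "D * r * (energy_level k p 1 u - energy_level k p 0 u)
    = ((\<Sum>i<k. (u (p i) + D * y i)\<^sup>2) - (\<Sum>i<k. u (p i) + D * y i)\<^sup>2 / real k)
      + D * (real k - 1) / real k * ((\<Sum>i<k. u (p i)) - (\<Sum>i<k. y i))\<^sup>2"
proof -
  have "(\<Sum>i<k. energy_level k p 0 (u \<circ> F k p i))
     = (\<Sum>i<k. real k * (\<Sum>j<k. (if j = i then u (p i) else y j)\<^sup>2) - (\<Sum>j<k. if j = i then u (p i) else y j)\<^sup>2)"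
    unfolding energy_0
    by (intro sum.cong arg_cong2[of _ _ _ _ "(-)"] arg_cong2[of _ _ _ _ "(*)"] arg_cong2[of _ _ _ _ "(^)"] refl)
       (auto simp: y)
  then have "D * (r * energy_level k p 1 u) =
    real k * (real k - 2) * energy_level k p 0 u
      + ((\<Sum>i<k. (u (p i) + D * y i)\<^sup>2) - ((\<Sum>i<k. u (p i)) + D * (\<Sum>i<k. y i))\<^sup>2 / real k)
      + D * (real k - 1) / real k * ((\<Sum>i<k. u (p i)) - (\<Sum>i<k. y i))\<^sup>2"
    unfolding energy_level_1 energy_0 by (simp only: cell_energy_identity)
  moreover have Dr: "real k * (real k - 2) = D * r"
    using D_pos by (simp add: r_eq)
  moreover have "D * r * (energy_level k p 1 u - energy_level k p 0 u)
      = D * (r * energy_level k p 1 u) - D * r * energy_level k p 0 u"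
    by (simp only: right_diff_distrib mult.assoc)
  ultimately show ?thesis
    unfolding Dr sum.distrib sum_distrib_left[symmetric] by linarith
qed

lemma energy_level_0_le_1: "energy_level k p 0 u \<le> energy_level k p 1 u"
proof -
  have "(\<Sum>i<k. u (p i) + D * u (qpt k p i))\<^sup>2 \<le> real k * (\<Sum>i<k. (u (p i) + D * u (qpt k p i))\<^sup>2)"
    using Cauchy_Schwarz_ineq_sum[of "\<lambda>_. 1" "\<lambda>i. u (p i) + D * u (qpt k p i)" "{..<k}"] by simp
  then have "0 \<le> D * r * (energy_level k p 1 u - energy_level k p 0 u)"
    using k3 D_pos by (subst D_energy_1[of u "\<lambda>j. u (qpt k p j)"])
      (auto simp: F_vertex pos_divide_le_eq mult.commute intro!: add_nonneg_nonneg)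
  moreover have "D * r > 0" using D_pos r_pos by simp
  ultimately show ?thesis
    by (simp add: zero_le_mult_iff)
qed

lemma energy_level_Suc_mono: "energy_level k p m u \<le> energy_level k p (Suc m) u"
proof -
  have "energy_level k p (m + 0) u \<le> energy_level k p (m + 1) u"
    unfolding energy_level_words using r_pos
    by (intro mult_left_mono sum_mono energy_level_0_le_1) auto
  then show ?thesis by simp
qed

lemma energy_level_mono: "m \<le> n \<Longrightarrow> energy_level k p m u \<le> energy_level k p n u"
  using energy_level_Suc_mono by (rule lift_Suc_mono_le)

text \<open>
  Monotonicity turns the limit defining the energy into a supremum.
\<close>
lemma energy_le_iff:
  assumes "0 \<le> c"
  shows "energy k p u \<le> ennreal c \<longleftrightarrow> (\<forall>m. energy_level k p m u \<le> c)"
proof -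
  have "incseq (\<lambda>m. ennreal (energy_level k p m u))"
    by (intro monoI ennreal_leI energy_level_mono)
  then have "energy k p u = (SUP m. ennreal (energy_level k p m u))"
    unfolding energy_def by (intro limI LIMSEQ_SUP)
  then show ?thesis
    using assms by (simp add: SUP_le_iff)
qed

section \<open>Oscillation bounds and resistance\<close>

text \<open>
  Twice the sum of the geometric series in \<open>\<surd>r\<close>: two points of a cell are compared through one of its
  vertices.
\<close>
definition osc_const :: real where "osc_const = 2 / (1 - sqrt r)"

lemma sqrt_r: "0 < sqrt r" "sqrt r < 1"
  using r_pos r_less_1 by auto

lemma osc_const_pos: "0 < osc_const"
  using sqrt_r by (simp add: osc_const_def)

lemma energy_0_ge:
  assumes "i < k" "j < k"
  shows "(u (p i) - u (p j))\<^sup>2 \<le> energy_level k p 0 u"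
proof -
  have *: "(u (p i) - u (p j))\<^sup>2 \<le> energy_level k p 0 u" if "i < j" "j < k" for i j
  proof -
    have "(u (p i) - u (p j))\<^sup>2 \<le> (\<Sum>i<j. (u (p i) - u (p j))\<^sup>2)"
      using that by (intro member_le_sum) auto
    also have "\<dots> \<le> (\<Sum>j<k. \<Sum>i<j. (u (p i) - u (p j))\<^sup>2)"
      using that by (intro member_le_sum[of j _ "\<lambda>j. \<Sum>i<j. (u (p i) - u (p j))\<^sup>2"]) (auto intro: sum_nonneg)
    finally show ?thesis by simp
  qed
  show ?thesis
    using *[of i j] *[of j i] assms energy_level_nonneg[of 0 u]
    by (cases i j rule: linorder_cases) (auto simp: power2_commute)
qed

text \<open>
  For a point of the \<open>i\<close>-th cell, pass through the vertex \<open>p\<^sub>i\<close>, which belongs to that cell: the step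
  between two vertices costs at most \<open>c\<close>, and inside the cell the energy is smaller by the factor
  \<open>r\<close>, so that the remaining steps add up to \<open>\<surd>r\<close> times the same bound.
\<close>
lemma osc_vertex:
  assumes "x \<in> Vstar k p" "l < k" "0 \<le> c" "\<And>m. energy_level k p m u \<le> c\<^sup>2"
  shows "\<bar>u x - u (p l)\<bar> \<le> c / (1 - sqrt r)"
  using assms
proof (induction arbitrary: u c l rule: Vstar_induct)
  case (vertex j)
  have "(u (p j) - u (p l))\<^sup>2 \<le> c\<^sup>2"
    using energy_0_ge[OF vertex.hyps vertex.prems(1), of u] vertex.prems(3)[of 0] by linarith
  then have "\<bar>u (p j) - u (p l)\<bar> \<le> c"
    using vertex.prems(2) by (metis abs_le_square_iff abs_of_nonneg)
  also have "c \<le> c / (1 - sqrt r)"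
    using vertex.prems(2) sqrt_r by (simp add: field_simps mult_left_le)
  finally show ?case .
next
  case (cell i y)
  have "energy_level k p m (u \<circ> F k p i) \<le> (sqrt r * c)\<^sup>2" for m
  proof -
    have "u \<circ> F k p i = u \<circ> Fw [i]" by auto
    then have "energy_level k p m (u \<circ> F k p i) \<le> r * energy_level k p (Suc m) u"
      using energy_level_Fw[of "[i]" 1 m u] cell.hyps by (simp add: words_def)
    also have "\<dots> \<le> r * c\<^sup>2"
      using r_pos by (intro mult_left_mono cell.prems(3)) simp
    finally show ?thesis using r_pos by (simp add: power_mult_distrib)
  qed
  from cell.IH[OF cell.hyps(1) _ this]
  have "\<bar>u (F k p i y) - u (p i)\<bar> \<le> sqrt r * c / (1 - sqrt r)"
    using cell.hyps cell.prems sqrt_r by simp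
  moreover have "\<bar>u (p i) - u (p l)\<bar> \<le> c"
  proof -
    have "(u (p i) - u (p l))\<^sup>2 \<le> c\<^sup>2"
      using energy_0_ge[OF cell.hyps(1) cell.prems(1), of u] cell.prems(3)[of 0] by linarith
    then show ?thesis
      using cell.prems(2) by (metis abs_le_square_iff abs_of_nonneg)
  qed
  ultimately have "\<bar>u (F k p i y) - u (p l)\<bar> \<le> sqrt r * c / (1 - sqrt r) + c"
    by linarith
  also have "\<dots> = c / (1 - sqrt r)"
    using sqrt_r by (simp add: field_simps)
  finally show ?case .
qed

lemma osc_cell:
  assumes "w \<in> words m" "x \<in> Vstar k p" "y \<in> Vstar k p" "\<And>m. energy_level k p m u \<le> 1"
  shows "\<bar>u (Fw w x) - u (Fw w y)\<bar> \<le> osc_const * sqrt r ^ m"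
proof -
  have k0: "0 < k" using k3 by simp
  have e: "energy_level k p n (u \<circ> Fw w) \<le> (sqrt r ^ m)\<^sup>2" for n
  proof -
    have "energy_level k p n (u \<circ> Fw w) \<le> r ^ m * energy_level k p (m + n) u"
      by (rule energy_level_Fw[OF assms(1)])
    also have "\<dots> \<le> r ^ m"
      using assms(4) r_pos by (intro mult_left_le) auto
    also have "r ^ m = (sqrt r ^ m)\<^sup>2"
      using r_pos by (simp flip: power_mult add: mult.commute[of m] power_mult)
    finally show ?thesis .
  qed
  have "\<bar>u (Fw w x) - u (Fw w (p 0))\<bar> \<le> sqrt r ^ m / (1 - sqrt r)"
    "\<bar>u (Fw w y) - u (Fw w (p 0))\<bar> \<le> sqrt r ^ m / (1 - sqrt r)"
    using osc_vertex[OF assms(2) k0 _ e] osc_vertex[OF assms(3) k0 _ e] sqrt_r by auto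
  then show ?thesis
    by (simp add: osc_const_def)
qed

text \<open>
  The square root of the resistance. In this form the triangle inequality is immediate, and for the
  square root it is all that uniform continuity needs.
\<close>
definition sqrt_res :: "'a \<Rightarrow> 'a \<Rightarrow> real" where
  "sqrt_res x y = Sup {\<bar>u x - u y\<bar> | u. \<forall>m. energy_level k p m u \<le> 1}"

lemma sqrt_res_bdd:
  assumes "x \<in> Vstar k p" "y \<in> Vstar k p"
  shows "bdd_above {\<bar>u x - u y\<bar> | u. \<forall>m. energy_level k p m u \<le> 1}"
proof (rule bdd_aboveI[of _ osc_const])
  fix t assume "t \<in> {\<bar>u x - u y\<bar> | u. \<forall>m. energy_level k p m u \<le> 1}"
  then show "t \<le> osc_const"
    using osc_cell[of "[]" 0, OF _ assms] by auto
qed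

lemma energy_level_zero [simp]: "energy_level k p m (\<lambda>x. 0) = 0"
  using energy_level_affine[of m 0 "\<lambda>x. 0" 0] by simp

lemma sqrt_res_ge:
  assumes "x \<in> Vstar k p" "y \<in> Vstar k p" "\<And>m. energy_level k p m u \<le> 1"
  shows "\<bar>u x - u y\<bar> \<le> sqrt_res x y"
  unfolding sqrt_res_def using assms by (intro cSup_upper sqrt_res_bdd) auto

lemma sqrt_res_le:
  assumes "\<And>u. \<lbrakk>\<And>m. energy_level k p m u \<le> 1\<rbrakk> \<Longrightarrow> \<bar>u x - u y\<bar> \<le> b"
  shows "sqrt_res x y \<le> b"
  unfolding sqrt_res_def
proof (rule cSup_least)
  show "{\<bar>u x - u y\<bar> | u. \<forall>m. energy_level k p m u \<le> 1} \<noteq> {}"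
    using energy_level_zero by (auto intro!: exI[of _ "\<lambda>x. 0"])
qed (use assms in auto)

lemma sqrt_res_nonneg: "\<lbrakk>x \<in> Vstar k p; y \<in> Vstar k p\<rbrakk> \<Longrightarrow> 0 \<le> sqrt_res x y"
  using sqrt_res_ge[of x y "\<lambda>x. 0"] by simp

lemma sqrt_res_refl [simp]: "sqrt_res x x = 0"
proof -
  have "{\<bar>u x - u x\<bar> | u. \<forall>m. energy_level k p m u \<le> 1} = {0}"
    by (auto intro!: exI[of _ "\<lambda>x. 0"])
  then show ?thesis by (simp add: sqrt_res_def)
qed

lemma sqrt_res_commute: "sqrt_res x y = sqrt_res y x"
  by (simp add: sqrt_res_def abs_minus_commute)

lemma sqrt_res_triangle:
  assumes "x \<in> Vstar k p" "y \<in> Vstar k p" "z \<in> Vstar k p"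
  shows "sqrt_res x z \<le> sqrt_res x y + sqrt_res y z"
proof (rule sqrt_res_le)
  fix u assume u: "\<And>m. energy_level k p m u \<le> 1"
  have "\<bar>u x - u z\<bar> \<le> \<bar>u x - u y\<bar> + \<bar>u y - u z\<bar>" by linarith
  also have "\<dots> \<le> sqrt_res x y + sqrt_res y z"
    using sqrt_res_ge assms u by (intro add_mono) auto
  finally show "\<bar>u x - u z\<bar> \<le> sqrt_res x y + sqrt_res y z" .
qed

lemma sqrt_res_cell:
  assumes "w \<in> words m" "x \<in> Vstar k p" "y \<in> Vstar k p"
  shows "sqrt_res (Fw w x) (Fw w y) \<le> osc_const * sqrt r ^ m"
  using osc_cell assms by (intro sqrt_res_le) auto

lemma sqrt_res_lower:
  assumes "x \<in> Vstar k p" "y \<in> Vstar k p" "0 < c" "\<And>m. energy_level k p m u \<le> c"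
  shows "(u x - u y)\<^sup>2 \<le> c * (sqrt_res x y)\<^sup>2"
proof -
  define v where "v = (\<lambda>x. 1 / sqrt c * u x + 0)"
  have "energy_level k p m v \<le> 1" for m
    unfolding v_def energy_level_affine using assms(3) assms(4)[of m]
    by (simp add: power_divide field_simps)
  then have "\<bar>v x - v y\<bar> \<le> sqrt_res x y"
    using assms sqrt_res_ge by blast
  moreover have "v x - v y = (u x - u y) / sqrt c"
    by (simp add: v_def diff_divide_distrib)
  ultimately have "((u x - u y) / sqrt c)\<^sup>2 \<le> (sqrt_res x y)\<^sup>2"
    by (metis abs_le_square_iff abs_ge_self order_trans)
  then show ?thesis
    using assms(3) by (simp add: power_divide field_simps)
qed

text \<open>
  Normalizing a function of finite energy either by its energy or by its increment from \<open>x\<close> to \<open>y\<close>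
  passes between the supremum and the infimum; the Dirichlet form is invariant under adding constants.
\<close>
theorem resistance_eq:
  assumes "x \<in> Vstar k p" "y \<in> Vstar k p"
  shows "resistance k p x y = (sqrt_res x y)\<^sup>2"
proof (cases "x = y")
  case False
  define S where "S = sqrt_res x y"
  define I where "I = (INF u\<in>{u. u x = 0 \<and> u y = 1}. energy k p u)"
  have S0: "0 \<le> S" using sqrt_res_nonneg assms by (simp add: S_def)
  have lower: "1 \<le> e * S\<^sup>2" if "u x = 0" "u y = 1" "0 < e" "energy k p u \<le> ennreal e" for u e
    using sqrt_res_lower[OF assms that(3), of u] that by (simp add: energy_le_iff S_def)
  show ?thesis
  proof (cases "S = 0")
    case True
    have "energy k p u = top" if "u x = 0" "u y = 1" for u
    proof (rule ccontr)
      assume "energy k p u \<noteq> top"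
      then obtain e where e: "energy k p u = ennreal e" "0 \<le> e"
        by (cases "energy k p u") auto
      then have "energy k p u \<le> ennreal (e + 1)" by (simp add: ennreal_leI)
      from lower[OF that _ this] e(2) True show False by simp
    qed
    then have "I = top"
      unfolding I_def by (simp add: INF_eq_const)
    then show ?thesis
      using False True by (simp add: resistance_def I_def S_def)
  next
    case S: False
    with S0 have Spos: "0 < S" by simp
    have I_ge: "ennreal (1 / S\<^sup>2) \<le> I"
      unfolding I_def
    proof (rule INF_greatest)
      fix u :: "'a \<Rightarrow> real" assume u: "u \<in> {u. u x = 0 \<and> u y = 1}"
      show "ennreal (1 / S\<^sup>2) \<le> energy k p u"
      proof (rule ccontr)
        assume "\<not> ennreal (1 / S\<^sup>2) \<le> energy k p u"
        then have less: "energy k p u < ennreal (1 / S\<^sup>2)" by simp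
        then obtain e where e: "energy k p u = ennreal e" "0 \<le> e" 
          by (cases "energy k p u") auto
        with less have e_less: "e < 1 / S\<^sup>2" by (simp add: ennreal_less_iff)
        \<comment> \<open>The energy may be zero; a slightly larger bound is positive and can be scaled away.\<close>
        define e' where "e' = (e + 1 / S\<^sup>2) / 2"
        have e': "e < e'" "e' < 1 / S\<^sup>2" using e_less by (simp_all add: e'_def)
        have "1 \<le> e' * S\<^sup>2"
          using lower[of u e'] u e e' by (simp add: ennreal_leI)
        with e'(2) Spos show False by (simp add: field_simps)
      qed
    qed
    have I_le: "I \<le> ennreal (1 / t\<^sup>2)" if u: "\<And>m. energy_level k p m u \<le> 1" "t = \<bar>u x - u y\<bar>" "0 < t" for u :: "'a \<Rightarrow> real" and t
    proof -
      define d where "d = u y - u x"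
      have d: "d \<noteq> 0" "t\<^sup>2 = d\<^sup>2" using u by (auto simp: d_def power2_commute)
      define v where "v = (\<lambda>z. (1 / d) * u z + (- u x / d))"
      have "v x = 0" "v y = 1"
        using d by (simp_all add: v_def d_def diff_divide_distrib[symmetric])
      moreover have "energy k p v \<le> ennreal (1 / t\<^sup>2)"
        unfolding energy_le_iff[OF zero_le_divide_1_iff[THEN iffD2, OF zero_le_power2]]
        unfolding v_def energy_level_affine d
        using u(1) d(1) by (auto simp: power_divide divide_right_mono)
      ultimately show ?thesis
        unfolding I_def by (intro INF_lower2[of v]) auto
    qed
    have "\<exists>u. (\<forall>m. energy_level k p m u \<le> 1) \<and> 0 < \<bar>u x - u y\<bar>"
    proof (rule ccontr)
      assume "\<not> ?thesis"
      then have "\<bar>u x - u y\<bar> \<le> 0" if "\<And>m. energy_level k p m u \<le> 1" for u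
        using that by (meson linorder_not_le)
      then have "S \<le> 0" unfolding S_def by (rule sqrt_res_le)
      with Spos show False by simp
    qed
    then obtain u where u: "\<And>m. energy_level k p m u \<le> 1" "0 < \<bar>u x - u y\<bar>"
      by blast
    \<comment> \<open>Now \<open>I\<close> is a positive real number, and the two bounds can be inverted.\<close>
    obtain i where i: "I = ennreal i" "0 \<le> i"
      using I_le[OF u(1) refl u(2)] by (cases I) (auto simp: top_unique)
    have i_ge: "1 / S\<^sup>2 \<le> i" using I_ge i by (simp add: ennreal_le_iff)
    moreover have "0 < 1 / S\<^sup>2" using Spos by simp
    ultimately have ipos: "0 < i" by linarith
    have "S \<le> sqrt (1 / i)"
      unfolding S_def
    proof (rule sqrt_res_le)
      fix u assume u: "\<And>m. energy_level k p m u \<le> 1"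
      show "\<bar>u x - u y\<bar> \<le> sqrt (1 / i)"
      proof (cases "u x = u y")
        case False
        then have "i \<le> 1 / (\<bar>u x - u y\<bar>)\<^sup>2"
          using I_le[OF u refl] i by (simp add: ennreal_le_iff)
        then have "(u x - u y)\<^sup>2 \<le> 1 / i"
          using False ipos by (simp add: field_simps)
        then show ?thesis by (simp add: real_le_rsqrt)
      qed (use ipos in simp)
    qed
    then have "S\<^sup>2 \<le> 1 / i"
      using Spos ipos power_mono[of S "sqrt (1 / i)" 2] by simp
    moreover have "1 / i \<le> S\<^sup>2"
      using i_ge ipos Spos by (simp add: field_simps)
    ultimately have "1 / i = S\<^sup>2" by simp
    then show ?thesis
      using False i ipos by (simp add: resistance_def flip: I_def S_def)
        (simp add: inverse_ennreal inverse_eq_divide)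
  qed
qed (simp add: resistance_def)

section \<open>Continuous extension of the resistance\<close>

lemma r_power_tendsto: "(\<lambda>m. c * sqrt r ^ m) \<longlonglongrightarrow> 0"
  using sqrt_r by (intro tendsto_mult_right_zero LIMSEQ_power_zero) simp

text \<open>
  Finitely many cells of one level are compact, so the disjoint ones have positive distance; hence
  Euclidean-close points lie in cells that meet. Cells meet only at vertices, and at such a vertex the
  oscillation bounds for the two cells combine.
\<close>
lemma sqrt_res_small:
  assumes "0 < e"
  obtains d where "0 < d"
    "\<And>x y. \<lbrakk>x \<in> Vstar k p; y \<in> Vstar k p; dist x y < d\<rbrakk> \<Longrightarrow> sqrt_res x y < e"
proof -
  obtain m where m: "2 * osc_const * sqrt r ^ m < e"
    using order_tendstoD(2)[OF r_power_tendsto assms] eventually_happens'[OF sequentially_bot] by blast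
  define A where "A = {(v, w) \<in> words m \<times> words m. Fw v ` K k p \<inter> Fw w ` K k p = {}}"
  define d where "d = Min (insert 1 ((\<lambda>(v, w). setdist (Fw v ` K k p) (Fw w ` K k p)) ` A))"
  have fin: "finite A"
    by (rule finite_subset[of _ "words m \<times> words m"]) (auto simp: A_def)
  have cpt: "compact (Fw v ` K k p)" if "v \<in> words m" for v
    by (intro compact_continuous_image continuous_Fw[OF that] compact_K)
  have ne: "K k p \<noteq> {}"
    using vertex_Vstar[of 0] Vstar_subset_K k3 by auto
  have "0 < d"
  proof -
    have "0 < setdist (Fw v ` K k p) (Fw w ` K k p)" if "(v, w) \<in> A" for v w
      using that ne cpt compact_imp_closed[OF cpt]
      by (subst setdist_gt_0_compact_closed) (auto simp: A_def)
    then show ?thesis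
      unfolding d_def using fin by (subst Min_gr_iff) auto
  qed
  moreover have "sqrt_res x y < e" if xy: "x \<in> Vstar k p" "y \<in> Vstar k p" "dist x y < d" for x y
  proof -
    obtain v a where v: "v \<in> words m" "a \<in> Vstar k p" "x = Fw v a"
      using xy(1) Vstar_cells[of m] by blast
    obtain w b where w: "w \<in> words m" "b \<in> Vstar k p" "y = Fw w b"
      using xy(2) Vstar_cells[of m] by blast
    have "(v, w) \<notin> A"
    proof
      assume "(v, w) \<in> A"
      then have "d \<le> setdist (Fw v ` K k p) (Fw w ` K k p)"
        unfolding d_def using fin by (intro Min_le) (auto intro!: image_eqI[of _ _ "(v, w)"])
      also have "\<dots> \<le> dist x y"
        using v w Vstar_subset_K by (intro setdist_le_dist) auto
      finally show False using xy(3) by simp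
    qed
    then obtain a' b' where ab: "a' \<in> K k p" "b' \<in> K k p" "Fw v a' = Fw w b'"
      using v w by (auto simp: A_def)
    have "sqrt_res x y \<le> 2 * osc_const * sqrt r ^ m"
    proof (cases "v = w")
      case True
      then have "sqrt_res x y \<le> osc_const * sqrt r ^ m"
        using sqrt_res_cell v w by auto
      moreover have "0 \<le> osc_const * sqrt r ^ m"
        using osc_const_pos sqrt_r by simp
      ultimately show ?thesis by simp
    next
      case False
      have V: "a' \<in> Vstar k p" "b' \<in> Vstar k p"
        using cells_meet[OF v(1) w(1) False ab] vertex_Vstar by auto
      have "sqrt_res x y \<le> sqrt_res x (Fw v a') + sqrt_res (Fw w b') y"
        using sqrt_res_triangle[OF xy(1) _ xy(2)] Fw_Vstar[OF v(1) V(1)] ab(3) by metis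
      also have "\<dots> \<le> osc_const * sqrt r ^ m + osc_const * sqrt r ^ m"
        unfolding v(3) w(3) by (intro add_mono sqrt_res_cell v w V)
      finally show ?thesis by simp
    qed
    with m show ?thesis by simp
  qed
  ultimately show thesis using that by blast
qed

lemma sqrt_res_le_const: "\<lbrakk>x \<in> Vstar k p; y \<in> Vstar k p\<rbrakk> \<Longrightarrow> sqrt_res x y \<le> osc_const"
  using sqrt_res_cell[of "[]" 0 x y] by simp

lemma uniformly_continuous_resistance:
  "uniformly_continuous_on (Vstar k p \<times> Vstar k p) (\<lambda>(x, y). resistance k p x y)"
  unfolding uniformly_continuous_on_def
proof (intro allI impI)
  fix e :: real assume e: "0 < e"
  define e' where "e' = e / (4 * osc_const)"
  have "0 < e'" using e osc_const_pos by (simp add: e'_def)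
  then obtain d where d: "0 < d"
    "\<And>x y. \<lbrakk>x \<in> Vstar k p; y \<in> Vstar k p; dist x y < d\<rbrakk> \<Longrightarrow> sqrt_res x y < e'"
    using sqrt_res_small by blast
  have *: "dist (resistance k p x y) (resistance k p x' y') < e"
    if V: "x \<in> Vstar k p" "y \<in> Vstar k p" "x' \<in> Vstar k p" "y' \<in> Vstar k p"
      and close: "dist x x' < d" "dist y y' < d" for x y x' y'
  proof -
    have "sqrt_res x y \<le> sqrt_res x x' + sqrt_res x' y' + sqrt_res y' y"
      using sqrt_res_triangle[of x x' y] sqrt_res_triangle[of x' y' y] V by simp
    moreover have "sqrt_res x' y' \<le> sqrt_res x' x + sqrt_res x y + sqrt_res y y'"
      using sqrt_res_triangle[of x' x y'] sqrt_res_triangle[of x y y'] V by simp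
    moreover have "sqrt_res x x' < e'" "sqrt_res y y' < e'"
      using d V close by auto
    ultimately have 1: "\<bar>sqrt_res x y - sqrt_res x' y'\<bar> < 2 * e'"
      using sqrt_res_commute by (simp add: abs_less_iff)
    have 2: "sqrt_res x y + sqrt_res x' y' \<le> 2 * osc_const" "0 \<le> sqrt_res x y + sqrt_res x' y'"
      using sqrt_res_le_const[of x y] sqrt_res_le_const[of x' y'] sqrt_res_nonneg[of x y]
        sqrt_res_nonneg[of x' y'] V by auto
    have "dist (resistance k p x y) (resistance k p x' y')
      = \<bar>sqrt_res x y - sqrt_res x' y'\<bar> * (sqrt_res x y + sqrt_res x' y')"
      using V 2(2) by (simp add: resistance_eq dist_real_def power2_eq_square square_diff_square_factored abs_mult)
    also have "\<dots> \<le> \<bar>sqrt_res x y - sqrt_res x' y'\<bar> * (2 * osc_const)"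
      using 2 by (intro mult_left_mono) auto
    also have "\<dots> < 2 * e' * (2 * osc_const)"
      using 1 osc_const_pos by (intro mult_strict_right_mono) auto
    also have "\<dots> = e" using osc_const_pos by (simp add: e'_def)
    finally show ?thesis .
  qed
  show "\<exists>d>0. \<forall>x\<in>Vstar k p \<times> Vstar k p. \<forall>x'\<in>Vstar k p \<times> Vstar k p. dist x' x < d \<longrightarrow>
      dist (case x' of (x, y) \<Rightarrow> resistance k p x y) (case x of (x, y) \<Rightarrow> resistance k p x y) < e"
  proof (intro exI[of _ d] conjI ballI impI d(1))
    fix s t assume st: "s \<in> Vstar k p \<times> Vstar k p" "t \<in> Vstar k p \<times> Vstar k p" "dist t s < d"
    then have "dist (fst t) (fst s) < d" "dist (snd t) (snd s) < d"
      using dist_fst_le[of t s] dist_snd_le[of t s] by linarith+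
    then show "dist (case t of (x, y) \<Rightarrow> resistance k p x y) (case s of (x, y) \<Rightarrow> resistance k p x y) < e"
      using * st by (auto simp: case_prod_unfold mem_Times_iff)
  qed
qed

lemma closure_Vstar_Times: "closure (Vstar k p \<times> Vstar k p) = K k p \<times> K k p"
  by (simp add: closure_Times K_eq_closure)

text \<open>
  A uniformly continuous function on the dense set \<open>V\<^sub>* \<times> V\<^sub>*\<close> has a unique continuous extension,
  so the definite description in \<open>resistance_metric\<close> has a solution.
\<close>
lemma continuous_resistance_metric:
    "continuous_on (K k p \<times> K k p) (\<lambda>(x, y). resistance_metric k p x y)"
  and resistance_metric_Vstar:
    "\<lbrakk>x \<in> Vstar k p; y \<in> Vstar k p\<rbrakk> \<Longrightarrow> resistance_metric k p x y = resistance k p x y"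
proof -
  define ok :: "('a \<Rightarrow> 'a \<Rightarrow> real) \<Rightarrow> bool" where
    "ok = (\<lambda>R. continuous_on (K k p \<times> K k p) (\<lambda>(x, y). R x y) \<and>
             (\<forall>x\<in>Vstar k p. \<forall>y\<in>Vstar k p. R x y = resistance k p x y) \<and>
             (\<forall>x y. (x, y) \<notin> K k p \<times> K k p \<longrightarrow> R x y = 0))"
  obtain g where g: "uniformly_continuous_on (K k p \<times> K k p) g"
      "\<And>z. z \<in> Vstar k p \<times> Vstar k p \<Longrightarrow> (case z of (x, y) \<Rightarrow> resistance k p x y) = g z"
    and unique: "\<And>Y h z. \<lbrakk>Vstar k p \<times> Vstar k p \<subseteq> Y; Y \<subseteq> K k p \<times> K k p; continuous_on Y h;
        \<And>z. z \<in> Vstar k p \<times> Vstar k p \<Longrightarrow> (case z of (x, y) \<Rightarrow> resistance k p x y) = h z;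
        z \<in> Y\<rbrakk> \<Longrightarrow> h z = g z"
    by (rule uniformly_continuous_on_extension_on_closure[OF uniformly_continuous_resistance,
        unfolded closure_Vstar_Times]) (rule that; blast)
  define R where "R = (\<lambda>x y. if (x, y) \<in> K k p \<times> K k p then g (x, y) else 0)"
  have "continuous_on (K k p \<times> K k p) (\<lambda>(x, y). R x y)"
    using uniformly_continuous_imp_continuous[OF g(1)]
    by (rule continuous_on_eq) (auto simp: R_def)
  then have R: "ok R"
    using g(2) Vstar_subset_K by (auto simp: ok_def R_def)
  have "R' = R" if "ok R'" for R'
  proof (intro ext)
    fix x y
    show "R' x y = R x y"
    proof (cases "(x, y) \<in> K k p \<times> K k p")
      case True
      have "(case (x, y) of (x, y) \<Rightarrow> R' x y) = g (x, y)"
        by (rule unique[of "K k p \<times> K k p"]) (use Vstar_subset_K True that in \<open>auto simp: ok_def\<close>)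
      with True show ?thesis by (simp add: R_def)
    next
      case False
      then show ?thesis using that R by (auto simp: ok_def)
    qed
  qed
  with R have "ok (resistance_metric k p)"
    unfolding resistance_metric_def ok_def[THEN fun_cong, symmetric] by (rule theI)
  then show "continuous_on (K k p \<times> K k p) (\<lambda>(x, y). resistance_metric k p x y)"
    "\<lbrakk>x \<in> Vstar k p; y \<in> Vstar k p\<rbrakk> \<Longrightarrow> resistance_metric k p x y = resistance k p x y"
    by (auto simp: ok_def)
qed

lemma continuous_resistance_metric_cells:
  assumes "v \<in> words m" "w \<in> words m"
  shows "continuous_on (closure (Vstar k p \<times> Vstar k p))
    (\<lambda>z. resistance_metric k p (Fw v (fst z)) (Fw w (snd z)))"
proof -
  have "continuous_on (K k p \<times> K k p) (\<lambda>z. (Fw v (fst z), Fw w (snd z)))"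
    by (intro continuous_on_Pair continuous_on_compose2[OF continuous_Fw[OF assms(1)]]
        continuous_on_compose2[OF continuous_Fw[OF assms(2)]] continuous_intros) auto
  moreover have "(\<lambda>z. (Fw v (fst z), Fw w (snd z))) ` (K k p \<times> K k p) \<subseteq> K k p \<times> K k p"
    using assms Fw_K by auto
  ultimately show ?thesis
    unfolding closure_Vstar_Times
    using continuous_on_compose2[OF continuous_resistance_metric, of "K k p \<times> K k p" "\<lambda>z. (Fw v (fst z), Fw w (snd z))"]
    by simp
qed

lemma resistance_metric_cell:
  assumes "w \<in> words m" "x \<in> K k p" "y \<in> K k p"
  shows "resistance_metric k p (Fw w x) (Fw w y) \<le> osc_const\<^sup>2 * r ^ m"
proof -
  have "resistance_metric k p (Fw w (fst (x, y))) (Fw w (snd (x, y))) \<le> osc_const\<^sup>2 * r ^ m"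
  proof (rule continuous_le_on_closure[OF continuous_resistance_metric_cells[OF assms(1) assms(1)]])
    show "(x, y) \<in> closure (Vstar k p \<times> Vstar k p)"
      using assms by (simp add: closure_Vstar_Times)
    fix z assume "z \<in> Vstar k p \<times> Vstar k p"
    then have z: "fst z \<in> Vstar k p" "snd z \<in> Vstar k p" by auto
    then have V: "Fw w (fst z) \<in> Vstar k p" "Fw w (snd z) \<in> Vstar k p"
      using Fw_Vstar assms(1) by auto
    have "(sqrt_res (Fw w (fst z)) (Fw w (snd z)))\<^sup>2 \<le> (osc_const * sqrt r ^ m)\<^sup>2"
      using sqrt_res_cell[OF assms(1) z] sqrt_res_nonneg[OF V] by (rule power_mono)
    also have "(sqrt r ^ m)\<^sup>2 = (sqrt r ^ 2) ^ m"
      by (simp only: mult.commute flip: power_mult)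
    then have "(osc_const * sqrt r ^ m)\<^sup>2 = osc_const\<^sup>2 * r ^ m"
      using r_pos by (simp add: power_mult_distrib)
    finally show "resistance_metric k p (Fw w (fst z)) (Fw w (snd z)) \<le> osc_const\<^sup>2 * r ^ m"
      using V by (simp add: resistance_metric_Vstar resistance_eq)
  qed
  then show ?thesis by simp
qed

section \<open>Piecewise harmonic functions\<close>

text \<open>
  The data on the vertices of the \<open>i\<close>-th cell for the energy-minimizing extension of the data \<open>g\<close> on
  \<open>V\<^sub>0\<close>, transported to \<open>V\<^sub>0\<close> by \<open>F\<^sub>i\<close>: the value at \<open>p\<^sub>j\<close> is the one prescribed at \<open>q\<^sub>j\<close>.
\<close>
definition harmonic_step :: "nat \<Rightarrow> ('a \<Rightarrow> real) \<Rightarrow> 'a \<Rightarrow> real" where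
  "harmonic_step i g z =
     (if z = p i then g z else ((real k - 1) * (\<Sum>l<k. g (p l)) - g z) / D)"

definition restrict_cell :: "nat \<Rightarrow> nat \<Rightarrow> ('a \<Rightarrow> real) \<Rightarrow> 'a \<Rightarrow> real" where
  "restrict_cell m i g = (if m = 0 then harmonic_step i g else g \<circ> F k p i)"

text \<open>
  The graph of the function on \<open>V\<^sub>*\<close> that agrees with \<open>g\<close> on \<open>V\<^sub>m\<close> and is harmonic below level \<open>m\<close>.
  A point has several addresses, so recursion along an address defines a relation at first. As long
  as the level is positive, passing to a cell only restricts \<open>g\<close>; from level 0 on, the data are
  subdivided harmonically, and truncated subtraction keeps the level at 0.
\<close>
inductive harmonic :: "nat \<Rightarrow> ('a \<Rightarrow> real) \<Rightarrow> 'a \<Rightarrow> real \<Rightarrow> bool" where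
  vertex: "j < k \<Longrightarrow> harmonic m g (p j) (g (p j))"
| cell: "\<lbrakk>i < k; x \<in> Vstar k p; harmonic (m - 1) (restrict_cell m i g) x v\<rbrakk>
    \<Longrightarrow> harmonic m g (F k p i x) v"

lemma restrict_cell_vertex: "i < k \<Longrightarrow> restrict_cell m i g (p i) = g (p i)"
  by (simp add: restrict_cell_def harmonic_step_def)

text \<open>
  Both sides are the value prescribed at \<open>q\<^sub>j\<close>, and the formula for it mentions only \<open>j\<close>.
\<close>
lemma restrict_cell_shared:
  assumes "i < k" "l < k" "j < k" "j \<noteq> i" "j \<noteq> l"
  shows "restrict_cell m i g (p j) = restrict_cell m l g (p j)"
  using assms vertex_inj[of j] by (auto simp: restrict_cell_def harmonic_step_def F_vertex)

lemma harmonic_vertex: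
  assumes "harmonic m g x v" "x = p j" "j < k"
  shows "v = g (p j)"
  using assms
proof (induction rule: harmonic.induct)
  case (cell i x m g v)
  then have "i = j" "x = p j"
    using F_eq_vertex[OF cell.hyps(1) cell.prems(2)] Vstar_solid by auto
  with cell show ?case
    by (simp add: restrict_cell_vertex)
qed simp

text \<open>
  Two different addresses of a point separate at a shared point \<open>q\<^sub>j\<close>, where the data agree.
\<close>
lemma harmonic_unique:
  assumes "harmonic m g x v" "harmonic m g x v'"
  shows "v = v'"
  using assms
proof (induction arbitrary: v' rule: harmonic.induct)
  case (vertex j m g)
  then show ?case using harmonic_vertex by metis
next
  case (cell i x m g v)
  from cell.prems show ?case
  proof cases
    case (vertex j)
    then show ?thesis
      using harmonic_vertex[OF harmonic.cell[OF cell.hyps]] by simp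
  next
    case (cell l y)
    note i = \<open>i < k\<close> \<open>x \<in> Vstar k p\<close>
    show ?thesis
    proof (cases "i = l")
      case True
      then show ?thesis
        using F_inj[OF i(1)] cell \<open>\<And>v'. harmonic (m - 1) (restrict_cell m i g) x v' \<Longrightarrow> v = v'\<close> by auto
    next
      case False
      obtain j where "j < k" "j \<noteq> i" "j \<noteq> l" "x = p j" "y = p j"
        using F_overlap_K[OF i(1) cell(2) False _ _ cell(1)] i cell Vstar_subset_K by blast
      then show ?thesis
        using restrict_cell_shared[OF i(1) cell(2)] 
          harmonic_vertex[OF \<open>harmonic (m - 1) (restrict_cell m i g) x v\<close>]
          harmonic_vertex[OF cell(4)] by simp
    qed
  qed
qed

lemma harmonic_total: "x \<in> Vstar k p \<Longrightarrow> \<exists>v. harmonic m g x v"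
  by (induction arbitrary: m g rule: Vstar_induct) (blast intro: harmonic.intros)+

definition harmonic_ext :: "nat \<Rightarrow> ('a \<Rightarrow> real) \<Rightarrow> 'a \<Rightarrow> real" where
  "harmonic_ext m g x = (THE v. harmonic m g x v)"

lemma harmonic_ext_eq: "harmonic m g x v \<Longrightarrow> harmonic_ext m g x = v"
  unfolding harmonic_ext_def using harmonic_unique by blast

lemma harmonic_ext_vertex: "j < k \<Longrightarrow> harmonic_ext m g (p j) = g (p j)"
  by (intro harmonic_ext_eq harmonic.vertex)

lemma harmonic_ext_F: "\<lbrakk>i < k; x \<in> Vstar k p\<rbrakk> \<Longrightarrow> harmonic_ext m g (F k p i x) = harmonic_ext (m - 1) (restrict_cell m i g) x"
  using harmonic_total harmonic_ext_eq harmonic.cell by metis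

lemma energy_1_harmonic: "energy_level k p 1 (harmonic_ext 0 g) = energy_level k p 0 g"
proof -
  define X where "X = (\<Sum>l<k. g (p l))"
  define y where "y = (\<lambda>j. ((real k - 1) * X - g (p j)) / D)"
  \<comment> \<open>Both squares in \<open>D_energy_1\<close> vanish: the numbers \<open>g (p i) + D * y i\<close> are equal and the sums agree.\<close>
  have eq: "g (p i) + D * y i = (real k - 1) * X" for i
    using D_pos by (simp add: y_def)
  have "(\<Sum>i<k. y i) = (\<Sum>i<k. (real k - 1) * X - g (p i)) / D"
    unfolding y_def by (rule sum_divide_distrib[symmetric])
  also have "(\<Sum>i<k. (real k - 1) * X - g (p i)) = real k * ((real k - 1) * X) - X"
    by (simp only: sum_subtractf X_def[symmetric]) simp
  also have "\<dots> = D * X"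
    by (simp add: D_def power2_eq_square algebra_simps)
  finally have Y: "(\<Sum>i<k. y i) = X"
    using D_pos by simp
  have "D * r * (energy_level k p 1 (harmonic_ext 0 g) - energy_level k p 0 (harmonic_ext 0 g)) = 0"
  proof (subst D_energy_1[of "harmonic_ext 0 g" y])
    show "harmonic_ext 0 g (F k p i (p j)) = y j" if "i < k" "j < k" "i \<noteq> j" for i j
      using that vertex_Vstar vertex_inj[of j i]
      by (auto simp: harmonic_ext_F harmonic_ext_vertex restrict_cell_def harmonic_step_def y_def X_def)
    have "(\<Sum>i<k. (harmonic_ext 0 g (p i) + D * y i)\<^sup>2) = (\<Sum>i<k. ((real k - 1) * X)\<^sup>2)"
      "(\<Sum>i<k. harmonic_ext 0 g (p i) + D * y i) = (\<Sum>i<k. (real k - 1) * X)"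
      "(\<Sum>i<k. harmonic_ext 0 g (p i)) = X"
      by (auto intro!: sum.cong simp: harmonic_ext_vertex eq X_def)
    then show "((\<Sum>i<k. (harmonic_ext 0 g (p i) + D * y i)\<^sup>2) - (\<Sum>i<k. harmonic_ext 0 g (p i) + D * y i)\<^sup>2 / real k)
      + D * (real k - 1) / real k * ((\<Sum>i<k. harmonic_ext 0 g (p i)) - (\<Sum>i<k. y i))\<^sup>2 = 0"
      using k3 by (simp add: Y power2_eq_square)
  qed
  then have "energy_level k p 1 (harmonic_ext 0 g) = energy_level k p 0 (harmonic_ext 0 g)"
    using D_pos r_pos by simp
  also have "\<dots> = energy_level k p 0 g"
    by (rule energy_level_cong) (auto simp: harmonic_ext_vertex)
  finally show ?thesis .
qed

text \<open>
  Restricted to a cell, a harmonic function is harmonic again, so every subdivision preserves the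
  energy by the case of the first one.
\<close>
lemma energy_harmonic_ext_0: "energy_level k p n (harmonic_ext 0 g) = energy_level k p 0 g"
proof (induction n arbitrary: g)
  case 0
  show ?case by (rule energy_level_cong) (auto simp: harmonic_ext_vertex)
next
  case (Suc n)
  have "energy_level k p n (harmonic_ext 0 g \<circ> F k p i) = energy_level k p 0 (harmonic_ext 0 g \<circ> F k p i)" if "i < k" for i
  proof -
    have "energy_level k p m (harmonic_ext 0 g \<circ> F k p i) = energy_level k p m (harmonic_ext 0 (restrict_cell 0 i g))" for m
      using that V_subset_Vstar[THEN subsetD] by (intro energy_level_cong) (auto simp: harmonic_ext_F)
    moreover have "energy_level k p n (harmonic_ext 0 (restrict_cell 0 i g)) = energy_level k p 0 (harmonic_ext 0 (restrict_cell 0 i g))"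
      unfolding Suc by (rule energy_level_cong) (auto simp: harmonic_ext_vertex)
    ultimately show ?thesis by (simp only:)
  qed
  then have "energy_level k p (Suc n) (harmonic_ext 0 g) = energy_level k p 1 (harmonic_ext 0 g)"
    by simp
  then show ?case by (simp only: energy_1_harmonic)
qed

lemma energy_harmonic_ext: "energy_level k p (m + n) (harmonic_ext m g) = energy_level k p m g"
proof (induction m arbitrary: g)
  case 0
  then show ?case by (simp add: energy_harmonic_ext_0)
next
  case (Suc m)
  have "energy_level k p (m + n) (harmonic_ext (Suc m) g \<circ> F k p i) = energy_level k p m (g \<circ> F k p i)" if "i < k" for i
  proof -
    have "energy_level k p (m + n) (harmonic_ext (Suc m) g \<circ> F k p i) = energy_level k p (m + n) (harmonic_ext m (g \<circ> F k p i))"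
      using that V_subset_Vstar[THEN subsetD] by (intro energy_level_cong) (auto simp: harmonic_ext_F restrict_cell_def)
    then show ?thesis by (simp only: Suc)
  qed
  then show ?case by simp
qed

lemma harmonic_ext_Fw: "\<lbrakk>w \<in> words m; x \<in> Vstar k p\<rbrakk> \<Longrightarrow> harmonic_ext m g (Fw w x) = harmonic_ext 0 (g \<circ> Fw w) x"
proof (induction m arbitrary: w g)
  case 0
  have "g \<circ> Fw [] = g" by auto
  with 0 show ?case by simp
next
  case (Suc m)
  obtain i v where w: "w = i # v" "i < k" "v \<in> words m"
    using Suc.prems(1) by (auto simp: words_Suc)
  have "(g \<circ> F k p i) \<circ> Fw v = g \<circ> Fw w" by (auto simp: w)
  then show ?case
    using w Suc.prems Suc.IH[OF w(3)] Fw_Vstar by (simp add: harmonic_ext_F restrict_cell_def)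
qed

lemma harmonic_ext_const:
  assumes "x \<in> Vstar k p" "\<And>j. j < k \<Longrightarrow> g (p j) = c"
  shows "harmonic_ext 0 g x = c"
  using assms
proof (induction arbitrary: g rule: Vstar_induct)
  case (vertex j)
  then show ?case by (simp add: harmonic_ext_vertex)
next
  case (cell i y)
  have "((real k - 1) * (real k * c) - c) / D = c"
    using D_pos by (simp add: field_simps) (simp add: D_def power2_eq_square algebra_simps)
  then have "harmonic_step i g (p j) = c" if "j < k" for j
    using that cell.hyps(1) cell.prems by (auto simp: harmonic_step_def)
  with cell show ?case
    by (simp add: harmonic_ext_F restrict_cell_def)
qed

section \<open>Separation of cells\<close>

lemma card_words_vertex: "j < k \<Longrightarrow> card {v \<in> words m. p j \<in> Fw v ` p ` {..<k}} \<le> 1"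
proof -
  assume j: "j < k"
  have "{v \<in> words m. p j \<in> Fw v ` p ` {..<k}} \<subseteq> {replicate m j}"
    using Fw_eq_vertex[OF _ j] vertex_Vstar Vstar_subset_K by fastforce
  then show ?thesis
    using card_mono[of "{replicate m j}"] by fastforce
qed

lemma Fw_vertex_K: "\<lbrakk>v \<in> words m; l < k\<rbrakk> \<Longrightarrow> Fw v (p l) \<in> K k p"
  using Fw_K vertex_Vstar Vstar_subset_K by blast

text \<open>
  Follow the address of \<open>z\<close> as long as only one cell contains it. If at some stage two cells do, then
  \<open>z\<close> corresponds to some \<open>q\<^sub>j\<close>, that is to the vertex \<open>p\<^sub>j\<close> in each of at most \<open>k\<close> cells, and a
  vertex has only one address.
\<close>
lemma card_words_point: "card {v \<in> words m. z \<in> Fw v ` p ` {..<k}} \<le> k"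
proof (induction m arbitrary: z)
  case 0
  have "card {v \<in> words 0. z \<in> Fw v ` p ` {..<k}} \<le> card {[] :: nat list}"
    by (intro card_mono) auto
  then show ?case using k3 by simp
next
  case (Suc m)
  define A where "A = (\<lambda>i. {v \<in> words m. z \<in> F k p i ` Fw v ` p ` {..<k}})"
  have finA: "finite (A i)" for i by (simp add: A_def)
  have split: "{v \<in> words (Suc m). z \<in> Fw v ` p ` {..<k}} = (\<Union>i<k. (#) i ` A i)"
    by (auto simp: words_Suc A_def image_image)
  show ?case
  proof (cases "\<exists>i<k. \<exists>l<k. i \<noteq> l \<and> A i \<noteq> {} \<and> A l \<noteq> {}")
    case True
    then obtain i l where il: "i < k" "l < k" "i \<noteq> l" and ne: "A i \<noteq> {}" "A l \<noteq> {}"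
      by blast
    obtain v a where v: "v \<in> words m" "a < k" "z = F k p i (Fw v (p a))"
      using ne(1) by (auto simp: A_def)
    obtain w b where w: "w \<in> words m" "b < k" "z = F k p l (Fw w (p b))"
      using ne(2) by (auto simp: A_def)
    obtain j where j: "j < k" "z = F k p i (p j)" "z = F k p l (p j)"
      using F_overlap_K[OF il Fw_vertex_K[OF v(1,2)] Fw_vertex_K[OF w(1,2)]] v(3) w(3) by metis
    have pj: "p j \<in> K k p" using j(1) vertex_Vstar Vstar_subset_K by blast
    have "A s \<subseteq> {v \<in> words m. p j \<in> Fw v ` p ` {..<k}}" if s: "s < k" for s
    proof
      fix v assume "v \<in> A s"
      then obtain a where a: "v \<in> words m" "a < k" "z = F k p s (Fw v (p a))"
        by (auto simp: A_def)
      obtain t where t: "t < k" "t \<noteq> s" "z = F k p t (p j)"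
        using il j by metis
      have "p j = Fw v (p a)"
        using F_overlap_K[OF t(1) s t(2) pj Fw_vertex_K[OF a(1,2)]] t(3) a(3) by metis
      then show "v \<in> {v \<in> words m. p j \<in> Fw v ` p ` {..<k}}"
        using a by auto
    qed
    then have "card (A s) \<le> 1" if "s < k" for s
      using card_words_vertex[OF j(1), of m] card_mono[of "{v \<in> words m. p j \<in> Fw v ` p ` {..<k}}" "A s"] that
      by fastforce
    then have "card (\<Union>i<k. (#) i ` A i) \<le> (\<Sum>i<k. 1)"
      by (intro order_trans[OF card_UN_le] sum_mono) (auto intro: order_trans[OF card_image_le[OF finA]])
    then show ?thesis by (simp add: split)
  next
    case False
    show ?thesis
    proof (cases "\<exists>i<k. A i \<noteq> {}")
      case True
      then obtain i where i: "i < k" "A i \<noteq> {}" by blast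
      then obtain y where y: "z = F k p i y" by (auto simp: A_def)
      have "l = i \<or> A l = {}" if "l < k" for l
        using False i that by blast
      then have "(\<Union>l<k. (#) l ` A l) \<subseteq> (#) i ` A i"
        by (intro UN_least) auto
      then have "card (\<Union>l<k. (#) l ` A l) \<le> card ((#) i ` A i)"
        using finA by (intro card_mono) auto
      also have "\<dots> \<le> card (A i)"
        by (rule card_image_le[OF finA])
      also have "A i \<subseteq> {v \<in> words m. y \<in> Fw v ` p ` {..<k}}"
      proof
        fix v assume "v \<in> A i"
        then obtain a where a: "v \<in> words m" "a < k" "F k p i y = F k p i (Fw v (p a))"
          by (auto simp: A_def y)
        then show "v \<in> {v \<in> words m. y \<in> Fw v ` p ` {..<k}}"
          using F_inj[OF i(1) a(3)] by blast
      qed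
      then have "card (A i) \<le> card {v \<in> words m. y \<in> Fw v ` p ` {..<k}}"
        by (intro card_mono) auto
      finally have "card (\<Union>l<k. (#) l ` A l) \<le> card {v \<in> words m. y \<in> Fw v ` p ` {..<k}}" .
      then show ?thesis using Suc.IH[of y] by (simp add: split)
    next
      case False
      then show ?thesis by (simp add: split)
    qed
  qed
qed

definition neighbours :: "nat \<Rightarrow> nat list \<Rightarrow> nat list set" where
  "neighbours m w = {v \<in> words m. Fw v ` p ` {..<k} \<inter> Fw w ` p ` {..<k} \<noteq> {}}"

lemma finite_neighbours: "finite (neighbours m w)"
  by (simp add: neighbours_def)

lemma card_neighbours: "card (neighbours m w) \<le> k * k"
proof -
  have "neighbours m w \<subseteq> (\<Union>j<k. {v \<in> words m. Fw w (p j) \<in> Fw v ` p ` {..<k}})"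
  proof
    fix v assume "v \<in> neighbours m w"
    then obtain x where v: "v \<in> words m" and x: "x \<in> Fw v ` p ` {..<k}" "x \<in> Fw w ` p ` {..<k}"
      unfolding neighbours_def by blast
    obtain j where "j < k" "x = Fw w (p j)" using x(2) by auto
    with v x(1) show "v \<in> (\<Union>j<k. {v \<in> words m. Fw w (p j) \<in> Fw v ` p ` {..<k}})"
      by (intro UN_I[of j]) auto
  qed
  then have "card (neighbours m w) \<le> card (\<Union>j<k. {v \<in> words m. Fw w (p j) \<in> Fw v ` p ` {..<k}})"
    by (intro card_mono) auto
  also have "\<dots> \<le> (\<Sum>j<k. k)"
    by (intro order_trans[OF card_UN_le] sum_mono card_words_point) auto
  finally show ?thesis by simp
qed

text \<open>
  Only neighbours of the cell contribute: there are at most \<open>k\<^sup>2\<close> of them, each with energy at most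
  \<open>k\<^sup>2\<close> before scaling.
\<close>
lemma energy_cell_indicator:
  assumes "w \<in> words m"
  shows "energy_level k p m (indicator (Fw w ` p ` {..<k})) \<le> inverse r ^ m * real k ^ 4"
proof -
  define g :: "'a \<Rightarrow> real" where "g = indicator (Fw w ` p ` {..<k})"
  have "(\<Sum>v\<in>words m. energy_level k p 0 (g \<circ> Fw v))
      = (\<Sum>v\<in>neighbours m w. energy_level k p 0 (g \<circ> Fw v))"
  proof (rule sum.mono_neutral_right)
    show "\<forall>v\<in>words m - neighbours m w. energy_level k p 0 (g \<circ> Fw v) = 0"
    proof
      fix v assume "v \<in> words m - neighbours m w"
      then have "g (Fw v (p j)) = 0" if "j < k" for j
        using that by (auto simp: neighbours_def g_def indicator_def)
      then show "energy_level k p 0 (g \<circ> Fw v) = 0" by (simp add: energy_0)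
    qed
  qed (auto simp: neighbours_def)
  also have "\<dots> \<le> (\<Sum>v\<in>neighbours m w. real k ^ 2)"
  proof (rule sum_mono)
    fix v
    have "energy_level k p 0 (g \<circ> Fw v) \<le> real k * (\<Sum>j<k. ((g \<circ> Fw v) (p j))\<^sup>2)"
      unfolding energy_0 by simp
    also have "\<dots> \<le> real k * (\<Sum>j<k. 1)"
      by (intro mult_left_mono sum_mono) (auto simp: g_def indicator_def)
    finally show "energy_level k p 0 (g \<circ> Fw v) \<le> real k ^ 2"
      by (simp add: power2_eq_square)
  qed
  also have "\<dots> \<le> real (k * k) * real k ^ 2"
    unfolding sum_constant using card_neighbours[of m w] by (intro mult_right_mono) (simp_all only: of_nat_le_iff, simp)
  also have "\<dots> = real k ^ 4" by (simp add: eval_nat_numeral)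
  finally show ?thesis
    unfolding g_def[symmetric] using energy_level_words[of m 0 g] r_pos
    by (simp add: mult_left_mono del: energy_level.simps)
qed

text \<open>
  The harmonic extension of the indicator of the vertices of one cell is constant 1 on that cell and
  constant 0 on every cell without a common vertex.
\<close>
lemma sqrt_res_separated:
  assumes w: "w \<in> words m" and v: "v \<in> words m" "v \<notin> neighbours m w"
    and xy: "x \<in> Vstar k p" "y \<in> Vstar k p"
  shows "r ^ m / real k ^ 4 \<le> (sqrt_res (Fw w x) (Fw v y))\<^sup>2"
proof -
  define g :: "'a \<Rightarrow> real" where "g = indicator (Fw w ` p ` {..<k})"
  define u where "u = harmonic_ext m g"
  define c where "c = inverse r ^ m * real k ^ 4"
  have c: "0 < c" using r_pos k3 by (simp add: c_def)
  have "energy_level k p n u \<le> c" for n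
  proof -
    have "energy_level k p n u \<le> energy_level k p (m + n) u"
      by (rule energy_level_mono) simp
    also have "\<dots> = energy_level k p m g"
      unfolding u_def by (rule energy_harmonic_ext)
    also have "\<dots> \<le> c"
      unfolding g_def c_def by (rule energy_cell_indicator[OF w])
    finally show ?thesis .
  qed
  then have "(u (Fw w x) - u (Fw v y))\<^sup>2 \<le> c * (sqrt_res (Fw w x) (Fw v y))\<^sup>2"
    using w v xy c by (intro sqrt_res_lower Fw_Vstar)
  moreover have "u (Fw w x) = 1"
    unfolding u_def harmonic_ext_Fw[OF w xy(1)]
    by (rule harmonic_ext_const[OF xy(1)]) (simp add: g_def)
  moreover have "u (Fw v y) = 0"
    unfolding u_def harmonic_ext_Fw[OF v(1) xy(2)]
    by (rule harmonic_ext_const[OF xy(2)]) (use v in \<open>auto simp: g_def neighbours_def indicator_def\<close>)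
  ultimately have "1 \<le> c * (sqrt_res (Fw w x) (Fw v y))\<^sup>2" by simp
  moreover have "r ^ m / real k ^ 4 = 1 / c"
    using r_pos by (simp add: c_def field_simps)
  ultimately show ?thesis
    using c by (simp add: field_simps)
qed

lemma resistance_metric_separated:
  assumes w: "w \<in> words m" and v: "v \<in> words m" "v \<notin> neighbours m w"
    and xy: "x \<in> K k p" "y \<in> K k p"
  shows "r ^ m / real k ^ 4 \<le> resistance_metric k p (Fw w x) (Fw v y)"
proof -
  have "r ^ m / real k ^ 4 \<le> resistance_metric k p (Fw w (fst (x, y))) (Fw v (snd (x, y)))"
  proof (rule continuous_ge_on_closure[OF continuous_resistance_metric_cells[OF w v(1)]])
    show "(x, y) \<in> closure (Vstar k p \<times> Vstar k p)"
      using xy by (simp add: closure_Vstar_Times)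
    fix z assume "z \<in> Vstar k p \<times> Vstar k p"
    then have z: "fst z \<in> Vstar k p" "snd z \<in> Vstar k p" by auto
    then show "r ^ m / real k ^ 4 \<le> resistance_metric k p (Fw w (fst z)) (Fw v (snd z))"
      using sqrt_res_separated[OF w v z] Fw_Vstar w v by (simp add: resistance_metric_Vstar resistance_eq)
  qed
  then show ?thesis by simp
qed

section \<open>Hausdorff dimension\<close>

text \<open>
  The solution of \<open>k r\<^sup>s = 1\<close>, see \<open>r_powr_sdim\<close>.
\<close>
definition sdim :: real where
  "sdim = ln (real k) / (ln D - ln (real k * (real k - 2)))"

lemma ln_r: "ln r = ln (real k * (real k - 2)) - ln D"
  unfolding r_eq using k3 D_pos by (intro ln_divide_pos) auto

lemma sdim_pos: "0 < sdim"
proof -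
  have "ln r < 0" using r_pos r_less_1 by simp
  then show ?thesis using k3 by (simp add: sdim_def ln_r)
qed

lemma r_powr_sdim: "r powr sdim = 1 / real k"
proof -
  have "ln r < 0" using r_pos r_less_1 by simp
  then have "sdim * ln r = - ln (real k)"
    unfolding sdim_def ln_r by (simp add: field_simps)
  then show ?thesis
    using r_pos k3 by (simp add: powr_def exp_minus inverse_eq_divide)
qed

text \<open>
  The \<open>k\<^sup>m\<close> cells of level \<open>m\<close> have diameter at most \<open>C r\<^sup>m\<close>, which gives the sum
  \<open>C\<^sup>s (k r\<^sup>s)\<^sup>m\<close>; the base is less than 1 for \<open>s\<close> above \<open>sdim\<close>.
\<close>
lemma hausdorff_measure_zero:
  assumes s: "sdim < s"
  shows "hausdorff_measure (K k p) (resistance_metric k p) s = 0"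
proof -
  define C where "C = osc_const\<^sup>2"
  have C: "0 < C" using osc_const_pos by (simp add: C_def)
  have s0: "0 < s" using s sdim_pos by linarith
  define q where "q = real k * r powr s"
  have q: "0 \<le> q" "q < 1"
  proof -
    have "r powr s < r powr sdim"
      using r_pos r_less_1 s by (intro powr_less_mono') auto
    then show "q < 1" using k3 by (simp add: q_def r_powr_sdim field_simps)
  qed (simp add: q_def)
  have "(INF A\<in>delta_covers (K k p) (resistance_metric k p) \<delta>.
      \<Sum>n. hausdorff_gauge (resistance_metric k p) s (A n)) = 0" if \<delta>: "0 < \<delta>" for \<delta>
  proof -
    have "(INF A\<in>delta_covers (K k p) (resistance_metric k p) \<delta>.
      \<Sum>n. hausdorff_gauge (resistance_metric k p) s (A n)) \<le> ennreal e" if e: "0 < e" for e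
    proof -
      have "(\<lambda>m. C * r ^ m) \<longlonglongrightarrow> 0" "(\<lambda>m. C powr s * q ^ m) \<longlonglongrightarrow> 0"
        using q r_pos r_less_1 by (intro tendsto_mult_right_zero LIMSEQ_power_zero; simp)+
      then have "eventually (\<lambda>m. C * r ^ m < \<delta> \<and> C powr s * q ^ m < e) sequentially"
        using order_tendstoD(2) \<delta> e by (intro eventually_conj) blast+
      then obtain m where m: "C * r ^ m < \<delta>" "C powr s * q ^ m < e"
        using eventually_happens'[OF sequentially_bot] by blast
      obtain h where h: "bij_betw h {0..<k ^ m} (words m)"
        using ex_bij_betw_nat_finite[OF finite_words[of m]] by (auto simp: card_words)
      define A where "A = (\<lambda>n. if n < k ^ m then Fw (h n) ` K k p else {})"
      have hw: "h n \<in> words m" if "n < k ^ m" for n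
        using h that by (auto simp: bij_betw_def)
      have diam: "mdiam (resistance_metric k p) (A n) \<le> ennreal (C * r ^ m)" for n
        using resistance_metric_cell[OF hw] by (intro mdiam_le) (auto simp: A_def C_def split: if_splits)
      have "(\<Union>n. A n) = (\<Union>n\<in>{0..<k ^ m}. Fw (h n) ` K k p)"
        by (auto simp: A_def split: if_splits)
      also have "\<dots> = (\<Union>w\<in>h ` {0..<k ^ m}. Fw w ` K k p)" by simp
      also have "\<dots> = K k p"
        using h K_cells[of m] by (simp add: bij_betw_def)
      finally have union: "(\<Union>n. A n) = K k p" .
      have "A \<in> delta_covers (K k p) (resistance_metric k p) \<delta>"
      proof -
        have "mdiam (resistance_metric k p) (A n) \<le> ennreal \<delta>" for n
          using diam[of n] ennreal_leI[OF less_imp_le[OF m(1)]] by (rule order_trans)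
        then show ?thesis
          using union by (simp add: delta_covers_def)
      qed
      then have "(INF A\<in>delta_covers (K k p) (resistance_metric k p) \<delta>.
          \<Sum>n. hausdorff_gauge (resistance_metric k p) s (A n))
          \<le> (\<Sum>n. hausdorff_gauge (resistance_metric k p) s (A n))"
        by (rule INF_lower)
      also have "\<dots> = (\<Sum>n\<in>{..<k ^ m}. hausdorff_gauge (resistance_metric k p) s (A n))"
        by (intro suminf_finite) (auto simp: A_def hausdorff_gauge_def)
      also have "\<dots> \<le> (\<Sum>n\<in>{..<k ^ m}. ennreal ((C * r ^ m) powr s))"
      proof (rule sum_mono)
        fix n
        have "enn2real (mdiam (resistance_metric k p) (A n)) \<le> C * r ^ m"
          using enn2real_mono[OF diam[of n]] C r_pos by simp
        then show "hausdorff_gauge (resistance_metric k p) s (A n) \<le> ennreal ((C * r ^ m) powr s)"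
          using s0 by (auto simp: hausdorff_gauge_def intro!: ennreal_leI powr_mono2)
      qed
      also have "\<dots> = ennreal (real k ^ m * (C * r ^ m) powr s)"
        by (simp add: ennreal_mult ennreal_of_nat_eq_real_of_nat)
      also have "real k ^ m * (C * r ^ m) powr s = C powr s * q ^ m"
        using C r_pos by (simp add: powr_mult q_def power_mult_distrib powr_realpow[symmetric] powr_powr mult.commute)
      also have "ennreal (C powr s * q ^ m) \<le> ennreal e"
        using m(2) by (intro ennreal_leI) simp
      finally show ?thesis .
    qed
    then show ?thesis
      by (metis ennreal_le_epsilon add_0 le_zero_eq zero_less_one)
  qed
  then show ?thesis
    by (simp add: hausdorff_measure_def)
qed

text \<open>
  In the resistance metric, cells of level \<open>m\<close> without a common vertex are at distance at least
  \<open>sep * r ^ m\<close>. The fourth power comes from \<open>k\<^sup>2\<close> neighbours with energy at most \<open>k\<^sup>2\<close> each.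
\<close>
definition sep :: real where "sep = 1 / real k ^ 4"

lemma sep_pos: "0 < sep" and sep_less_1: "sep < 1"
proof -
  show "0 < sep" using k3 by (simp add: sep_def)
  have "1 < real k ^ 4" using k3 by (intro one_less_power) auto
  then show "sep < 1" using k3 by (simp add: sep_def divide_less_eq)
qed

text \<open>
  For positive \<open>t\<close>, the last level at which cells are still separated by more than \<open>t\<close> has
  \<open>r\<^sup>m\<close> comparable to \<open>t\<close>, so that \<open>k\<^sup>-\<^sup>m\<close> is comparable to \<open>t\<close> to the power \<open>sdim\<close>. The summand
  \<open>\<eta>\<close> covers \<open>t = 0\<close>, where every level separates.
\<close>
lemma scale_exists:
  assumes t: "0 \<le> t" "t < sep" and \<eta>: "0 < \<eta>"
  obtains m where "t < sep * r ^ m" "1 / real k ^ m \<le> real k * (t / sep) powr sdim + \<eta>"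
proof (cases "t = 0")
  case True
  have "(\<lambda>m. (1 / real k) ^ m) \<longlonglongrightarrow> 0"
    using k3 by (intro LIMSEQ_power_zero) simp
  then obtain m where "(1 / real k) ^ m < \<eta>"
    using order_tendstoD(2)[OF _ \<eta>] eventually_happens'[OF sequentially_bot] by blast
  with True sep_pos r_pos show thesis
    using that[of m] by (simp add: power_divide)
next
  case False
  with t have tpos: "0 < t" by simp
  have "(\<lambda>m. sep * r ^ m) \<longlonglongrightarrow> 0"
    using r_pos r_less_1 by (intro tendsto_mult_right_zero LIMSEQ_power_zero) simp
  then have ex: "\<exists>m. sep * r ^ m < t"
    using order_tendstoD(2)[OF _ tpos] eventually_happens'[OF sequentially_bot] by blast
  define N where "N = (LEAST m. sep * r ^ m \<le> t)"
  have N: "sep * r ^ N \<le> t"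
    unfolding N_def by (rule LeastI_ex) (use ex less_imp_le in blast)
  with t(2) have "N \<noteq> 0" by (auto intro: ccontr)
  then obtain m where m: "N = Suc m" by (cases N) auto
  then have "\<not> sep * r ^ m \<le> t"
    unfolding N_def by (metis lessI not_less_Least)
  moreover have "1 / real k ^ m \<le> real k * (t / sep) powr sdim"
  proof -
    have "r ^ Suc m \<le> t / sep"
      using N sep_pos by (simp add: m field_simps)
    then have "(r ^ Suc m) powr sdim \<le> (t / sep) powr sdim"
      using r_pos sdim_pos by (intro powr_mono2) auto
    moreover have "(r ^ Suc m) powr sdim = (1 / real k) ^ Suc m"
      unfolding r_powr_sdim[symmetric] using r_pos
      by (simp add: powr_realpow[symmetric] powr_powr mult.commute del: power_Suc)
    ultimately have "(1 / real k) ^ Suc m \<le> (t / sep) powr sdim" by simp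
    from mult_left_mono[OF this, of "real k"] show ?thesis
      using k3 by (simp add: power_divide)
  qed
  ultimately show thesis
    using that[of m] \<eta> by simp
qed

lemma card_cells_meeting:
  assumes A: "A \<subseteq> K k p" and small: "mdiam (resistance_metric k p) A < ennreal (sep * r ^ m)"
  shows "card {v \<in> words m. Fw v ` K k p \<inter> A \<noteq> {}} \<le> k * k"
proof (cases "A = {}")
  case False
  then obtain x where x: "x \<in> A" by blast
  then obtain w a where w: "w \<in> words m" "a \<in> K k p" "x = Fw w a"
    using A K_cells[of m] by blast
  have "{v \<in> words m. Fw v ` K k p \<inter> A \<noteq> {}} \<subseteq> neighbours m w"
  proof (rule subsetI, rule ccontr)
    fix v assume *: "v \<in> {v \<in> words m. Fw v ` K k p \<inter> A \<noteq> {}}" and "v \<notin> neighbours m w"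
    from * obtain b where v: "v \<in> words m" and b: "b \<in> K k p" "Fw v b \<in> A" by blast
    with \<open>v \<notin> neighbours m w\<close> have "sep * r ^ m \<le> resistance_metric k p x (Fw v b)"
      using resistance_metric_separated[OF w(1) v _ w(2) b(1)] by (simp add: w(3) sep_def)
    then have "ennreal (sep * r ^ m) \<le> mdiam (resistance_metric k p) A"
      unfolding mdiam_def using x b
      by (intro SUP_upper2[OF x] SUP_upper2[OF b(2)] ennreal_leI)
    with small show False by simp
  qed
  then show ?thesis
    by (rule order_trans[OF card_mono[OF finite_neighbours] card_neighbours])
qed simp

lemma code_point:
  assumes "\<And>i. \<omega> i < k"
  obtains z where "\<And>m. z \<in> Fw (map \<omega> [0..<m]) ` K k p"
proof -
  have w: "map \<omega> [0..<m] \<in> words m" for m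
    using assms by (auto simp: words_def)
  have Suc: "Fw (map \<omega> [0..<Suc m]) ` K k p \<subseteq> Fw (map \<omega> [0..<m]) ` K k p" for m
    using Fw_K[of "[\<omega> m]" 1] assms by (auto simp: Fw_append words_def)
  have "\<Inter> (range (\<lambda>m. Fw (map \<omega> [0..<m]) ` K k p)) \<noteq> {}"
  proof (rule compact_nest)
    show "compact (Fw (map \<omega> [0..<m]) ` K k p)" for m
      by (intro compact_continuous_image continuous_Fw[OF w] compact_K)
    show "Fw (map \<omega> [0..<m]) ` K k p \<noteq> {}" for m
      using vertex_Vstar[of 0] Vstar_subset_K k3 by auto
    show "m \<le> n \<Longrightarrow> Fw (map \<omega> [0..<n]) ` K k p \<subseteq> Fw (map \<omega> [0..<m]) ` K k p" for m n
      using Suc by (rule lift_Suc_antimono_le)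
  qed
  then show thesis using that by blast
qed

text \<open>
  Otherwise some infinite word avoids all cells that meet a member of the cover at the level chosen
  for it. The point with that address lies in some \<open>A n\<close>, and in the cell of level \<open>m n\<close> given by its
  address, which is a contradiction.
\<close>
lemma cover_weight_ge_1:
  assumes cover: "(\<Union>n. A n) = K k p"
    and small: "\<And>n. mdiam (resistance_metric k p) (A n) < ennreal (sep * r ^ m n)"
  shows "1 \<le> (\<Sum>n. ennreal (if A n = {} then 0 else real (k * k) / real k ^ m n))"
proof (rule ccontr)
  assume *: "\<not> ?thesis"
  define B where "B = (\<lambda>n. {v \<in> words (m n). Fw v ` K k p \<inter> A n \<noteq> {}})"
  have card: "real (card (B n)) \<le> real (k * k)" for n
    unfolding B_def using cover small[of n] by (intro of_nat_mono card_cells_meeting) auto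
  have "(\<Sum>n. ennreal (real (card (B n)) / real k ^ m n))
      \<le> (\<Sum>n. ennreal (if A n = {} then 0 else real (k * k) / real k ^ m n))"
  proof (intro suminf_le allI summableI ennreal_leI)
    fix n show "real (card (B n)) / real k ^ m n \<le> (if A n = {} then 0 else real (k * k) / real k ^ m n)"
    proof (cases "A n = {}")
      case True
      then show ?thesis by (simp add: B_def)
    next
      case False
      then show ?thesis using card[of n] by (simp only: if_False divide_right_mono zero_le_power of_nat_0_le_iff)
    qed
  qed
  with * have "(\<Sum>n. ennreal (real (card (B n)) / real k ^ m n)) < 1"
    by simp
  note less = this
  have fin: "finite (B n)" for n
    by (simp add: B_def)
  have len: "length v = m n" if "v \<in> B n" for n v
    using that by (simp add: B_def words_def)
  have "\<exists>\<omega>. (\<forall>i. \<omega> i < k) \<and> (\<forall>n. map \<omega> [0..<m n] \<notin> B n)"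
    by (rule infinite_word_avoiding[OF _ fin len less]) (use k3 in auto)
  then obtain \<omega> where \<omega>: "\<And>i. \<omega> i < k" "\<And>n. map \<omega> [0..<m n] \<notin> B n"
    by blast
  obtain z where z: "\<And>m. z \<in> Fw (map \<omega> [0..<m]) ` K k p"
    using code_point \<omega>(1) by blast
  have "z \<in> K k p" using z[of 0] by simp
  then obtain n where "z \<in> A n" using cover by auto
  then have "map \<omega> [0..<m n] \<in> B n"
    using z[of "m n"] \<omega>(1) by (auto simp: B_def words_def)
  with \<omega>(2) show False by blast
qed

text \<open>
  Let each set of a cover choose the level matching its diameter; the cover then has total word weight
  at least 1, while that weight is at most a constant times the sum of the gauges plus \<open>1/2\<close>. As the
  diameters are at most 1, the exponent \<open>s\<close> only enlarges the gauge.
\<close>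
lemma hausdorff_measure_nonzero:
  assumes s: "0 \<le> s" "s < sdim"
  shows "hausdorff_measure (K k p) (resistance_metric k p) s \<noteq> 0"
proof -
  define R where "R = resistance_metric k p"
  define a where "a = real k ^ 3 * (1 / sep) powr sdim"
  have a: "0 < a" using k3 sep_pos by (simp add: a_def)
  have "ennreal (1 / (4 * a)) \<le> (\<Sum>n. hausdorff_gauge R s (A n))"
    if "A \<in> delta_covers (K k p) R (sep / 2)" for A
  proof -
    have cover: "(\<Union>n. A n) = K k p" and diam: "\<And>n. mdiam R (A n) \<le> ennreal (sep / 2)"
      using that by (auto simp: delta_covers_def)
    define t where "t = (\<lambda>n. enn2real (mdiam R (A n)))"
    have t: "mdiam R (A n) = ennreal (t n)" "0 \<le> t n" "t n \<le> sep / 2" for n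
    proof -
      have "mdiam R (A n) < top" using diam[of n] by (simp add: le_less_trans)
      then show 1: "mdiam R (A n) = ennreal (t n)" by (simp add: t_def)
      show 0: "0 \<le> t n" by (simp add: t_def)
      show "t n \<le> sep / 2" using diam[of n] sep_pos by (simp add: 1 ennreal_le_iff)
    qed
    \<comment> \<open>The error terms, multiplied by the \<open>k\<^sup>2\<close> cells that a set can meet, sum to \<open>1/2\<close>.\<close>
    have "\<forall>n. \<exists>m. t n < sep * r ^ m \<and>
        1 / real k ^ m \<le> real k * (t n / sep) powr sdim + (1/2) ^ Suc n / (2 * real k ^ 2)"
    proof
      fix n
      have "t n < sep" using t(3)[of n] sep_pos by linarith
      moreover have "0 < (1/2) ^ Suc n / (2 * real k ^ 2)" using k3 by simp
      ultimately show "\<exists>m. t n < sep * r ^ m \<and>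
        1 / real k ^ m \<le> real k * (t n / sep) powr sdim + (1/2) ^ Suc n / (2 * real k ^ 2)"
        using scale_exists[OF t(2)] by metis
    qed
    then obtain m where m: "\<And>n. t n < sep * r ^ m n"
      "\<And>n. 1 / real k ^ m n \<le> real k * (t n / sep) powr sdim + (1/2) ^ Suc n / (2 * real k ^ 2)"
      by metis
    have "1 \<le> (\<Sum>n. ennreal (if A n = {} then 0 else real (k * k) / real k ^ m n))"
      using m(1) t by (intro cover_weight_ge_1 cover) (simp add: R_def[symmetric] ennreal_less_iff)
    also have "\<dots> \<le> (\<Sum>n. ennreal a * hausdorff_gauge R s (A n) + ennreal ((1/2) * (1/2) ^ Suc n))"
    proof (intro suminf_le allI summableI)
      fix n
      show "ennreal (if A n = {} then 0 else real (k * k) / real k ^ m n)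
         \<le> ennreal a * hausdorff_gauge R s (A n) + ennreal ((1/2) * (1/2) ^ Suc n)"
      proof (cases "A n = {}")
        case False
        have tn: "enn2real (mdiam R (A n)) = t n" by (simp add: t_def)
        have "t n \<le> 1" using t(3)[of n] sep_less_1 by simp
        then have gauge: "ennreal (t n powr sdim) \<le> hausdorff_gauge R s (A n)"
          using False t(2)[of n] s by (auto simp: hausdorff_gauge_def tn intro!: powr_mono' ennreal_leI powr_le1)
        have "real (k * k) * (1 / real k ^ m n)
            \<le> real (k * k) * (real k * (t n / sep) powr sdim + (1/2) ^ Suc n / (2 * real k ^ 2))"
          by (intro mult_left_mono m(2)) simp
        also have "\<dots> = real k ^ 3 * (t n / sep) powr sdim + (1/2) * (1/2) ^ Suc n"
          using k3 by (simp add: distrib_left eval_nat_numeral)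
        also have "(t n / sep) powr sdim = t n powr sdim * (1 / sep) powr sdim"
          using t(2)[of n] sep_pos by (simp flip: powr_mult)
        finally have "real (k * k) / real k ^ m n \<le> a * t n powr sdim + (1/2) * (1/2) ^ Suc n"
          by (simp add: a_def mult_ac)
        then have "ennreal (real (k * k) / real k ^ m n) \<le> ennreal (a * t n powr sdim + (1/2) * (1/2) ^ Suc n)"
          by (rule ennreal_leI)
        also have "\<dots> = ennreal a * ennreal (t n powr sdim) + ennreal ((1/2) * (1/2) ^ Suc n)"
          using a by (subst ennreal_plus) (auto simp: ennreal_mult)
        also have "\<dots> \<le> ennreal a * hausdorff_gauge R s (A n) + ennreal ((1/2) * (1/2) ^ Suc n)"
          by (intro add_right_mono mult_left_mono gauge) simp
        finally show ?thesis using False by simp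
      qed simp
    qed
    also have "\<dots> = ennreal a * (\<Sum>n. hausdorff_gauge R s (A n)) + (\<Sum>n. ennreal ((1/2) * (1/2) ^ Suc n))"
      by (simp only: suminf_add[symmetric, OF summableI summableI] ennreal_suminf_cmult)
    also have "(\<Sum>n. ennreal ((1/2) * (1/2) ^ Suc n)) = ennreal (1/2)"
    proof (rule suminf_ennreal_eq)
      show "(\<lambda>n. (1/2) * (1/2) ^ Suc n :: real) sums (1/2)"
        using sums_mult[OF power_half_series, of "1/2"] by simp
    qed simp
    finally have le: "1 \<le> ennreal a * (\<Sum>n. hausdorff_gauge R s (A n)) + ennreal (1/2)" .
    show ?thesis
    proof (rule ccontr)
      assume "\<not> ?thesis"
      then have "(\<Sum>n. hausdorff_gauge R s (A n)) \<le> ennreal (1 / (4 * a))" by simp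
      then have "ennreal a * (\<Sum>n. hausdorff_gauge R s (A n)) \<le> ennreal a * ennreal (1 / (4 * a))"
        by (rule mult_left_mono) simp
      also have "\<dots> = ennreal (1/4)"
        using a by (simp flip: ennreal_mult)
      finally have "1 \<le> ennreal (1/4) + ennreal (1/2)"
        using le by (meson add_right_mono order_trans)
      also have "\<dots> = ennreal (3/4)" by (subst ennreal_plus[symmetric]) auto
      finally show False by simp
    qed
  qed
  then have "ennreal (1 / (4 * a)) \<le> (INF A\<in>delta_covers (K k p) R (sep / 2). \<Sum>n. hausdorff_gauge R s (A n))"
    by (rule INF_greatest)
  also have "\<dots> \<le> hausdorff_measure (K k p) R s"
    unfolding hausdorff_measure_def using sep_pos by (intro SUP_upper) auto
  finally have "ennreal (1 / (4 * a)) \<le> hausdorff_measure (K k p) R s" .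
  moreover have "0 < ennreal (1 / (4 * a))" using a by simp
  ultimately show ?thesis
    unfolding R_def by (metis leD)
qed

theorem hausdorff_dim_K: "hausdorff_dim (K k p) (resistance_metric k p) = ereal sdim"
proof (rule antisym)
  show "hausdorff_dim (K k p) (resistance_metric k p) \<le> ereal sdim"
  proof (rule ereal_le_epsilon2)
    fix e :: real assume "0 < e"
    then show "hausdorff_dim (K k p) (resistance_metric k p) \<le> ereal sdim + ereal e"
      unfolding hausdorff_dim_def
      using hausdorff_measure_zero[of "sdim + e"] sdim_pos by (intro INF_lower2[of "sdim + e"]) auto
  qed
  show "ereal sdim \<le> hausdorff_dim (K k p) (resistance_metric k p)"
    unfolding hausdorff_dim_def using hausdorff_measure_nonzero
    by (intro INF_greatest) (auto simp: not_less[symmetric])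
qed

end

theorem corollary5p9:
  fixes k :: nat and p :: "nat \<Rightarrow> real ^ 'n"
  assumes "k \<ge> 3" and "CARD('n) = k - 1" and "regular_simplex k p"
  shows "hausdorff_dim (K k p) (resistance_metric k p) =
         ereal (ln (real k) / (ln ((real k)\<^sup>2 - real k - 1) - ln (real k * (real k - 2))))"
proof -
  interpret simplex_fractal k p
    by standard (use assms in auto)
  show ?thesis
    using hausdorff_dim_K by (simp add: sdim_def D_def)
qed

end
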